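(* Let $\omega\geq 2$ and $D\geq 3$. Up to isomorphism, there are only finitely many $2$-walk-regular graphs with diameter $D$ and smallest eigenvalue at least $-\omega$ that are not geometric.
   Context: All graphs are finite, simple and connected. For $t\geq 0$, a graph is $t$-walk-regular if it has diameter at least $t$ and, for every $\ell\geq 0$, the number of walks of length $\ell$ between two vertices $x,y$ depends only on $\mathrm{dist}(x,y)$, provided $\mathrm{dist}(x,y)\leq t$. Such a graph is regular, say with valency $k$; eigenvalues are those of the adjacency matrix, and $\theta_d$ denotes the smallest eigenvalue. A Delsarte clique is a clique with exactly $1-k/\theta_d$ vertices. A graph is geometric if there exists a set of Delsarte cliques such that every edge lies in exactly one of them. *)

theory Defs
  imports
    Graph_Theory.Graph_Theory
    Jordan_Normal_Form.Spectral_Radius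
begin

text \<open>
  Graphs are modelled as in the Graph_Theory entry: a finite simple graph is a finite, loopfree
  digraph without parallel arcs whose arc relation is symmetric (locale graph). Each undirected
  edge is thus a pair of opposite arcs, and walks are the walks along arcs.
\<close>

definition graph_dist :: "('a, 'b) pre_digraph \<Rightarrow> 'a \<Rightarrow> 'a \<Rightarrow> ereal" where
  "graph_dist G u v = wf_digraph.\<mu> G (\<lambda>_. 1) u v"

definition graph_diameter :: "('a, 'b) pre_digraph \<Rightarrow> ereal" where
  "graph_diameter G = (SUP u\<in>verts G. SUP v\<in>verts G. graph_dist G u v)"

definition num_walks :: "('a, 'b) pre_digraph \<Rightarrow> nat \<Rightarrow> 'a \<Rightarrow> 'a \<Rightarrow> nat" where
  "num_walks G l u v = card {p. pre_digraph.awalk G u p v \<and> length p = l}"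

definition walk_regular :: "nat \<Rightarrow> ('a, 'b) pre_digraph \<Rightarrow> bool" where
  "walk_regular t G \<longleftrightarrow>
     ereal (real t) \<le> graph_diameter G \<and>
     (\<forall>l. \<forall>x\<in>verts G. \<forall>y\<in>verts G. \<forall>x'\<in>verts G. \<forall>y'\<in>verts G.
        graph_dist G x y \<le> ereal (real t) \<longrightarrow> graph_dist G x' y' = graph_dist G x y \<longrightarrow>
        num_walks G l x' y' = num_walks G l x y)"

text \<open>
  The matrix type of Jordan_Normal_Form is indexed by an initial segment of the naturals, so
  the adjacency matrix depends on an enumeration of the vertices. Its eigenvalues do not;
  see \<open>eigenvalue_adjacency_matrix_iff\<close>.
\<close>

definition vertex_list :: "('a, 'b) pre_digraph \<Rightarrow> 'a list" where
  "vertex_list G = (SOME vs. distinct vs \<and> set vs = verts G)"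

definition adjacency_matrix :: "('a, 'b) pre_digraph \<Rightarrow> real mat" where
  "adjacency_matrix G = mat (card (verts G)) (card (verts G))
     (\<lambda>(i, j). if (vertex_list G ! i, vertex_list G ! j) \<in> arcs_ends G then 1 else 0)"

definition smallest_eigenvalue :: "('a, 'b) pre_digraph \<Rightarrow> real" where
  "smallest_eigenvalue G = Min (spectrum (adjacency_matrix G))"

definition regular_graph :: "('a, 'b) pre_digraph \<Rightarrow> nat \<Rightarrow> bool" where
  "regular_graph G k \<longleftrightarrow> (\<forall>v\<in>verts G. out_degree G v = k)"

definition clique :: "('a, 'b) pre_digraph \<Rightarrow> 'a set \<Rightarrow> bool" where
  "clique G C \<longleftrightarrow> C \<subseteq> verts G \<and> (\<forall>u\<in>C. \<forall>v\<in>C. u \<noteq> v \<longrightarrow> (u, v) \<in> arcs_ends G)"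

definition Delsarte_clique :: "('a, 'b) pre_digraph \<Rightarrow> 'a set \<Rightarrow> bool" where
  "Delsarte_clique G C \<longleftrightarrow> clique G C \<and>
     (\<exists>k. regular_graph G k \<and> real (card C) = 1 - real k / smallest_eigenvalue G)"

definition geometric :: "('a, 'b) pre_digraph \<Rightarrow> bool" where
  "geometric G \<longleftrightarrow> (\<exists>\<C>. (\<forall>C\<in>\<C>. Delsarte_clique G C) \<and>
     (\<forall>(u, v)\<in>arcs_ends G. \<exists>!C. C \<in> \<C> \<and> u \<in> C \<and> v \<in> C))"

lemma graph_dist_le_iff:
  assumes "wf_digraph G"
  shows "graph_dist G u v \<le> ereal (real n) \<longleftrightarrow>
    (\<exists>p. pre_digraph.awalk G u p v \<and> length p \<le> n)"
proof -
  interpret wf_digraph G by (rule assms)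
  have cost: "awalk_cost (\<lambda>_. 1) p = real (length p)" for p
    by (induction p) auto
  show ?thesis
  proof
    assume "\<exists>p. awalk u p v \<and> length p \<le> n"
    then obtain p where p: "awalk u p v" "length p \<le> n" by blast
    have "\<mu> (\<lambda>_. 1) u v \<le> ereal (real (length p))"
      using min_cost_le_walk_cost[OF p(1), of "\<lambda>_. 1"] by (simp add: cost)
    with p(2) show "graph_dist G u v \<le> ereal (real n)"
      unfolding graph_dist_def by (meson ereal_less_eq(3) of_nat_le_iff order_trans)
  next
    assume "graph_dist G u v \<le> ereal (real n)"
    then have "\<mu> (\<lambda>_. 1) u v < ereal (real n + 1)"
      unfolding graph_dist_def by (rule le_less_trans) simp
    then obtain p where "awalk u p v" "real (length p) < real n + 1"
      unfolding \<mu>_def INF_less_iff cost by auto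
    then show "\<exists>p. awalk u p v \<and> length p \<le> n" by force
  qed
qed

lemma vertex_list:
  assumes "finite (verts G)"
  shows "distinct (vertex_list G)" "set (vertex_list G) = verts G"
    "length (vertex_list G) = card (verts G)"
proof -
  have "\<exists>vs. distinct vs \<and> set vs = verts G"
    using finite_distinct_list[OF assms] by blast
  from someI_ex[OF this] show *: "distinct (vertex_list G)" "set (vertex_list G) = verts G"
    unfolding vertex_list_def by auto
  then show "length (vertex_list G) = card (verts G)"
    by (metis distinct_card)
qed

lemma eigenvalue_adjacency_matrix_iff:
  assumes "finite (verts G)"
  shows "eigenvalue (adjacency_matrix G) \<theta> \<longleftrightarrow>
    (\<exists>x. (\<exists>v\<in>verts G. x v \<noteq> 0) \<and>
      (\<forall>u\<in>verts G. (\<Sum>v\<in>verts G. (if (u, v) \<in> arcs_ends G then 1 else 0) * x v) = \<theta> * x u))"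
proof -
  define n where "n = card (verts G)"
  define f where "f = (\<lambda>i. vertex_list G ! i)"
  define a :: "'a \<Rightarrow> 'a \<Rightarrow> real" where "a = (\<lambda>u v. if (u, v) \<in> arcs_ends G then 1 else 0)"
  have bij: "bij_betw f {0..<n} (verts G)"
    unfolding f_def n_def using vertex_list[OF assms]
    by (intro bij_betw_nth) (auto simp: atLeast0LessThan)
  have A: "adjacency_matrix G = mat n n (\<lambda>(i, j). a (f i) (f j))"
    by (simp add: adjacency_matrix_def n_def f_def a_def)
  have reindex: "(\<Sum>v\<in>verts G. h v) = (\<Sum>j=0..<n. h (f j))" for h :: "'a \<Rightarrow> real"
    using sum.reindex_bij_betw[OF bij, of h] by simp
  have rhs: "(\<exists>v\<in>verts G. x v \<noteq> 0) \<and>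
      (\<forall>u\<in>verts G. (\<Sum>v\<in>verts G. (if (u, v) \<in> arcs_ends G then 1 else 0) * x v) = \<theta> * x u)
    \<longleftrightarrow> (\<exists>i<n. x (f i) \<noteq> 0) \<and> (\<forall>i<n. (\<Sum>j=0..<n. a (f i) (f j) * x (f j)) = \<theta> * x (f i))" for x
  proof -
    have V: "verts G = f ` {0..<n}" using bij by (simp add: bij_betw_def)
    have ex: "(\<exists>v\<in>verts G. P v) \<longleftrightarrow> (\<exists>i<n. P (f i))" for P
      unfolding V by auto
    have all: "(\<forall>v\<in>verts G. P v) \<longleftrightarrow> (\<forall>i<n. P (f i))" for P
      unfolding V by auto
    show ?thesis unfolding ex all reindex a_def ..
  qed
  have row: "(adjacency_matrix G *\<^sub>v w) $ i = (\<Sum>j=0..<n. a (f i) (f j) * w $ j)"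
    if "w \<in> carrier_vec n" "i < n" for w i
    using that by (simp add: A scalar_prod_def)
  have dim: "dim_row (adjacency_matrix G) = n" by (simp add: A)
  show ?thesis
  proof
    assume "eigenvalue (adjacency_matrix G) \<theta>"
    then obtain w where w: "w \<in> carrier_vec n" "w \<noteq> 0\<^sub>v n"
      "adjacency_matrix G *\<^sub>v w = \<theta> \<cdot>\<^sub>v w"
      by (auto simp: eigenvalue_def eigenvector_def dim)
    define x where "x = (\<lambda>v. w $ the_inv_into {0..<n} f v)"
    have x: "x (f i) = w $ i" if "i < n" for i
      using bij that by (simp add: x_def the_inv_into_f_f bij_betw_def)
    have "\<exists>i<n. w $ i \<noteq> 0"
    proof (rule ccontr)
      assume "\<not> (\<exists>i<n. w $ i \<noteq> 0)"
      then have "w = 0\<^sub>v n" using w(1) by (intro eq_vecI) auto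
      with w(2) show False ..
    qed
    then have "\<exists>i<n. x (f i) \<noteq> 0" using x by auto
    moreover have "(\<Sum>j=0..<n. a (f i) (f j) * x (f j)) = \<theta> * x (f i)" if "i < n" for i
      using row[OF w(1) that] that w(1) by (simp add: w(3) x)
    ultimately show "\<exists>x. (\<exists>v\<in>verts G. x v \<noteq> 0) \<and>
      (\<forall>u\<in>verts G. (\<Sum>v\<in>verts G. (if (u, v) \<in> arcs_ends G then 1 else 0) * x v) = \<theta> * x u)"
      unfolding rhs by blast
  next
    assume "\<exists>x. (\<exists>v\<in>verts G. x v \<noteq> 0) \<and>
      (\<forall>u\<in>verts G. (\<Sum>v\<in>verts G. (if (u, v) \<in> arcs_ends G then 1 else 0) * x v) = \<theta> * x u)"
    then obtain x where x: "\<exists>i<n. x (f i) \<noteq> 0"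
      "\<And>i. i < n \<Longrightarrow> (\<Sum>j=0..<n. a (f i) (f j) * x (f j)) = \<theta> * x (f i)"
      unfolding rhs by blast
    define w where "w = vec n (\<lambda>i. x (f i))"
    have w: "w \<in> carrier_vec n" by (simp add: w_def)
    from x(1) obtain i where i: "i < n" "x (f i) \<noteq> 0" by blast
    have "w \<noteq> 0\<^sub>v n"
    proof
      assume "w = 0\<^sub>v n"
      then have "w $ i = 0" using i(1) by simp
      with i show False by (simp add: w_def)
    qed
    moreover have "adjacency_matrix G *\<^sub>v w = \<theta> \<cdot>\<^sub>v w"
    proof (rule eq_vecI)
      fix i assume "i < dim_vec (\<theta> \<cdot>\<^sub>v w)"
      then have i: "i < n" by (simp add: w_def)
      show "(adjacency_matrix G *\<^sub>v w) $ i = (\<theta> \<cdot>\<^sub>v w) $ i"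
        unfolding row[OF w i] using x(2)[OF i] i by (simp add: w_def)
    qed (simp add: dim w_def)
    ultimately show "eigenvalue (adjacency_matrix G) \<theta>"
      using w unfolding eigenvalue_def eigenvector_def dim by blast
  qed
qed

end

theory Submission
  imports Defs "HOL-Analysis.Function_Topology"
begin

text \<open>
  Let $k$, $\lambda$, $\mu$ be the valency and the numbers of common neighbours of two vertices at
  distance $1$ and $2$, and put $q = \lfloor \omega^2 \rfloor$. As the smallest eigenvalue is at least
  $-\omega$, neighbourhoods contain no independent set of more than $q$ vertices; hence
  $k \le q(\lambda + 1)$.

  If $\lambda$ is large compared with $\mu$, the maximal cliques of size about $\lambda$ (lines)
  partition the edges, and every vertex is on the same number $s$ of lines. There are fewer lines than
  vertices, so $-s$ is the smallest eigenvalue, and since its idempotent is constant on edges and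
  annihilates the indicator function of each line, all lines have size $1 + k/s$: the graph is
  geometric.

  Otherwise $k = O(\mu)$, so counting the layers around a vertex yields $O(k)$ vertices. A pair of
  vertices at distance $3$ forces a nonconstant eigenfunction with eigenvalue $\theta > k/(2\omega)$.
  Taking the trace of $A^2$, the multiplicity of $\theta$ is bounded, and Godsil's bound limits $k$ in
  terms of that multiplicity. Together with the diameter this bounds the number of vertices.
\<close>

section \<open>The spectral theorem for symmetric kernels on a finite set\<close>

text \<open>Walk-regularity fixes walk counts only up to distance 2: no intersection numbers beyond
  \<mu> are available, and a spectral idempotent is known to be constant only at distances 0, 1 and
  2. The dividing line is \<lambda> \<ge> 2q(q+1)\<mu>. A clique built around a point of an
  independent set in a neighbourhood falls short of \<lambda> + 2 by at most q\<mu>, and the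
  threshold makes this loss harmless wherever it occurs. Below it, k \<le> q(\<lambda>+1) becomes k
  \<le> 2q^2(q+1)\<mu>, whence |V| \<le> Ck with C depending on \<omega> and D alone. The trace
  needs exactly this linear bound: mult * \<theta>^2 \<le> |V|k and \<theta> > k/(2\<omega>) give
  mult \<le> 4\<omega>^2 C, all powers of k cancelling. Godsil's bound requires the idempotent entry
  at distance 0 to differ from those at distances 1 and 2. The former holds because a nonconstant
  eigenfunction changes along some edge; the case where the latter fails is settled
  combinatorially.\<close>

lemma quadratic_nonneg_imp_zero:
  fixes p r :: real
  assumes nonneg: "\<And>t. 0 \<le> 2 * t * p + t\<^sup>2 * r" and "p \<ge> 0"
  shows "p = 0"
proof (rule ccontr)
  assume "p \<noteq> 0"
  with \<open>p \<ge> 0\<close> have p: "p > 0" by simp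
  define s where "s = \<bar>r\<bar> + 1"
  have s: "s > 0" by (simp add: s_def)
  \<comment> \<open>For r > 0 the minimum is at - p / r; the positive \<open>s > r\<close> in place
    of \<open>r\<close> saves a case distinction on the sign of \<open>r\<close>.\<close>
  have "0 \<le> 2 * (- p / s) * p + (- p / s)\<^sup>2 * r" by (rule nonneg)
  also have "\<dots> = (p / s)\<^sup>2 * (r - 2 * s)"
    using s by (simp add: power2_eq_square field_simps)
  also have "\<dots> < 0"
    using p s by (intro mult_pos_neg) (auto simp: s_def)
  finally show False by simp
qed

locale symmetric_kernel =
  fixes V :: "'a set" and a :: "'a \<Rightarrow> 'a \<Rightarrow> real"
  assumes finite_V: "finite V"
    and a_sym: "\<lbrakk>x \<in> V; y \<in> V\<rbrakk> \<Longrightarrow> a x y = a y x"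
begin

definition ip :: "('a \<Rightarrow> real) \<Rightarrow> ('a \<Rightarrow> real) \<Rightarrow> real" where
  "ip f g = (\<Sum>x\<in>V. f x * g x)"

text \<open>The value 0 outside \<open>V\<close>, together with \<open>supported\<close>, turns the
  eigenfunction condition into an equation between functions, so that equality on \<open>V\<close>
  is equality and sets of eigenfunctions can be counted.\<close>

definition ap :: "('a \<Rightarrow> real) \<Rightarrow> 'a \<Rightarrow> real" where
  "ap f x = (if x \<in> V then \<Sum>y\<in>V. a x y * f y else 0)"

definition supported :: "('a \<Rightarrow> real) \<Rightarrow> bool" where
  "supported f \<longleftrightarrow> (\<forall>x. x \<notin> V \<longrightarrow> f x = 0)"

lemma ip_commute: "ip f g = ip g f"
  by (simp add: ip_def mult.commute)

lemma ip_self_nonneg: "ip f f \<ge> 0"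
  by (simp add: ip_def sum_nonneg)

lemma ip_self_eq_0: "ip f f = 0 \<longleftrightarrow> (\<forall>x\<in>V. f x = 0)"
  using finite_V by (simp add: ip_def sum_nonneg_eq_0_iff)

lemma ip_add_scale: "ip f (\<lambda>x. g x + t * h x) = ip f g + t * ip f h"
  by (simp add: ip_def sum.distrib sum_distrib_left algebra_simps)

lemma ap_add_scale: "ap (\<lambda>x. g x + t * h x) = (\<lambda>x. ap g x + t * ap h x)"
  by (rule ext) (simp add: ap_def sum.distrib sum_distrib_left algebra_simps)

lemma ip_ap_commute: "ip f (ap g) = ip (ap f) g"
proof -
  have "ip f (ap g) = (\<Sum>x\<in>V. \<Sum>y\<in>V. f x * (a x y * g y))"
    by (simp add: ip_def ap_def sum_distrib_left)
  also have "\<dots> = (\<Sum>y\<in>V. \<Sum>x\<in>V. f x * (a x y * g y))"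
    by (rule sum.swap)
  also have "\<dots> = ip (ap f) g"
    by (simp add: ip_def ap_def sum_distrib_left sum_distrib_right a_sym mult.commute
        mult.left_commute cong: sum.cong)
  finally show ?thesis .
qed

lemma supported_ap: "supported (ap f)"
  by (simp add: supported_def ap_def)

lemma continuous_on_ip:
  assumes "\<And>x. continuous_on A (\<lambda>f. F f x)" "\<And>x. continuous_on A (\<lambda>f. H f x)"
  shows "continuous_on A (\<lambda>f. ip (F f) (H f))"
  unfolding ip_def by (intro continuous_intros assms)

lemma continuous_on_ap:
  assumes "\<And>x. continuous_on A (\<lambda>f. F f x)"
  shows "continuous_on A (\<lambda>f. ap (F f) x)"
  unfolding ap_def by (cases "x \<in> V") (auto intro!: continuous_intros assms)

text \<open>A closed subset of a product of intervals, compact by Tychonoff. The type may be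
  infinite; \<open>supported\<close> keeps the coordinates outside \<open>V\<close> inside the
  cube.\<close>

lemma compact_unit_sphere:
  "compact {f. supported f \<and> (\<forall>u\<in>S. ip u f = 0) \<and> ip f f = 1}" (is "compact ?K")
proof -
  have "compactin (product_topology (\<lambda>_. euclidean) UNIV) (UNIV \<rightarrow>\<^sub>E {-1..1::real})"
    by (simp add: compactin_PiE)
  then have cube: "compact ((UNIV :: 'a set) \<rightarrow>\<^sub>E {-1..1::real})"
    by (simp add: euclidean_product_topology)
  have coord: "continuous_on UNIV (\<lambda>f::'a \<Rightarrow> real. f x)" for x
    by simp
  have "?K = (\<Inter>x\<in>-V. {f. f x = 0}) \<inter> (\<Inter>u\<in>S. {f. ip u f = 0}) \<inter> {f. ip f f = 1}"
    by (auto simp: supported_def)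
  moreover have "closed \<dots>"
    by (intro closed_Int closed_INT ballI closed_Collect_eq continuous_on_ip coord continuous_intros)
  ultimately have closed: "closed ?K" by simp
  have "?K \<subseteq> UNIV \<rightarrow>\<^sub>E {-1..1::real}"
  proof
    fix f assume f: "f \<in> ?K"
    have "\<bar>f x\<bar> \<le> 1" for x
    proof (cases "x \<in> V")
      case True
      have "(f x)\<^sup>2 \<le> (\<Sum>x\<in>V. (f x)\<^sup>2)"
        using finite_V True by (intro member_le_sum) auto
      also have "\<dots> = 1" using f by (simp add: ip_def power2_eq_square)
      finally show ?thesis by (simp add: abs_square_le_1)
    next
      case False
      then show ?thesis using f by (simp add: supported_def)
    qed
    then show "f \<in> UNIV \<rightarrow>\<^sub>E {-1..1}" by (auto simp: abs_le_iff minus_le_iff)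
  qed
  with compact_Int_closed[OF cube closed] show ?thesis by (simp add: Int_absorb1)
qed

text \<open>
  A minimiser of the Rayleigh quotient on the orthogonal complement of the eigenfunctions found
  so far is itself an eigenfunction.
\<close>

lemma ex_orthogonal_eigenfunction:
  assumes S: "\<And>u. u \<in> S \<Longrightarrow> \<exists>c. ap u = (\<lambda>x. c * u x)"
    and h: "supported h" "\<And>u. u \<in> S \<Longrightarrow> ip u h = 0" "ip h h \<noteq> 0"
  shows "\<exists>f. supported f \<and> (\<forall>u\<in>S. ip u f = 0) \<and> ip f f = 1 \<and> (\<exists>c. ap f = (\<lambda>x. c * f x))"
proof -
  define W where "W = {f. supported f \<and> (\<forall>u\<in>S. ip u f = 0)}"
  define K where "K = {f. supported f \<and> (\<forall>u\<in>S. ip u f = 0) \<and> ip f f = 1}"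
  define Q where "Q = (\<lambda>f. ip f (ap f))"
  have scale: "ip f (\<lambda>x. t * g x) = t * ip f g" for f g t
    by (simp add: ip_def sum_distrib_left algebra_simps)
  have ap_scale: "ap (\<lambda>x. t * g x) = (\<lambda>x. t * ap g x)" for g t
    by (rule ext) (simp add: ap_def sum_distrib_left algebra_simps)
  have normalise: "(\<lambda>x. f x / sqrt (ip f f)) \<in> K" if "f \<in> W" "ip f f \<noteq> 0" for f
  proof -
    have pos: "ip f f > 0" using that ip_self_nonneg[of f] by linarith
    have "ip (\<lambda>x. f x / sqrt (ip f f)) (\<lambda>x. f x / sqrt (ip f f))
      = ip f f / (sqrt (ip f f))\<^sup>2"
      unfolding ip_def by (simp add: sum_divide_distrib power2_eq_square)
    also have "\<dots> = 1" using pos by simp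
    finally have "ip (\<lambda>x. f x / sqrt (ip f f)) (\<lambda>x. f x / sqrt (ip f f)) = 1" .
    moreover have "ip u (\<lambda>x. f x / sqrt (ip f f)) = 0" if "u \<in> S" for u
      using scale[of u "1 / sqrt (ip f f)" f] \<open>f \<in> W\<close> that by (simp add: W_def)
    ultimately show ?thesis using that by (simp add: K_def W_def supported_def)
  qed
  have "h \<in> W" using h by (simp add: W_def)
  then have "K \<noteq> {}" using normalise h(3) by blast
  moreover have "compact K" unfolding K_def by (rule compact_unit_sphere)
  moreover have "continuous_on K Q"
    unfolding Q_def by (intro continuous_on_ip continuous_on_ap)
      (auto intro: continuous_on_subset[OF continuous_on_product_coordinates])
  ultimately obtain f where f: "f \<in> K" and min: "\<And>g. g \<in> K \<Longrightarrow> Q f \<le> Q g"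
    using continuous_attains_inf by metis
  define \<theta> where "\<theta> = Q f"
  have lower: "\<theta> * ip g g \<le> Q g" if "g \<in> W" for g
  proof (cases "ip g g = 0")
    case True
    then have "\<forall>x\<in>V. g x = 0" by (simp only: ip_self_eq_0)
    then have "Q g = 0" by (simp add: Q_def ip_def)
    with True show ?thesis by simp
  next
    case False
    have pos: "ip g g > 0" using False ip_self_nonneg[of g] by linarith
    define r where "r = 1 / sqrt (ip g g)"
    have r: "r * r * ip g g = 1"
      using pos by (simp add: r_def)
    have "\<theta> \<le> Q (\<lambda>x. g x / sqrt (ip g g))"
      unfolding \<theta>_def by (rule min[OF normalise[OF that False]])
    also have "(\<lambda>x. g x / sqrt (ip g g)) = (\<lambda>x. r * g x)" by (simp add: r_def)
    also have "Q (\<lambda>x. r * g x) = r * r * Q g"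
      by (simp add: Q_def ap_scale scale ip_commute[of "\<lambda>x. r * g x"] ip_commute[of g])
    finally have "\<theta> * ip g g \<le> r * r * Q g * ip g g"
      using pos by (simp add: mult_right_mono)
    also have "\<dots> = (r * r * ip g g) * Q g" by (simp only: mult.assoc mult.commute mult.left_commute)
    also have "\<dots> = Q g" using r by simp
    finally show ?thesis .
  qed
  \<comment> \<open>The residual of \<open>f\<close> as an eigenfunction. It stays in
    \<open>W\<close> because the elements of \<open>S\<close> are eigenfunctions and the kernel is
    symmetric.\<close>
  define g where "g = (\<lambda>x. ap f x + (- \<theta>) * f x)"
  have f1: "supported f" "ip f f = 1" "\<And>u. u \<in> S \<Longrightarrow> ip u f = 0"
    using f by (auto simp: K_def)
  have "ip u g = 0" if u: "u \<in> S" for u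
  proof -
    obtain c where "ap u = (\<lambda>x. c * u x)" using S[OF u] by blast
    then have "ip u (ap f) = 0"
      using f1(3)[OF u] scale[of f c u] by (simp add: ip_ap_commute ip_commute)
    then show ?thesis
      unfolding g_def ip_add_scale using f1(3)[OF u] by simp
  qed
  moreover have "supported g"
    using f1(1) supported_ap[of f] by (simp add: g_def supported_def)
  ultimately have gW: "g \<in> W" by (simp add: W_def)
  have "(\<lambda>x. f x + t * g x) \<in> W" for t
    using gW f1 by (simp add: W_def ip_add_scale) (simp add: supported_def)
  note low = lower[OF this]
  have fg: "ip g (ap f) = ip g g + \<theta> * ip f g"
  proof -
    have "ip g g = ip g (ap f) + (- \<theta>) * ip g f"
      by (subst (2) g_def) (rule ip_add_scale)
    then show ?thesis using ip_commute[of g f] by simp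
  qed
  have norm_g: "ip g g = ip f (ap g) - \<theta> * ip f g"
    using fg ip_commute[of g "ap f"] ip_ap_commute[of f g] by simp
  \<comment> \<open>The Rayleigh bound along f + t g, constant terms cancelled. The linear
    coefficient is twice the squared norm of \<open>g\<close>, which must therefore vanish.\<close>
  have "0 \<le> 2 * t * ip g g + t\<^sup>2 * (Q g - \<theta> * ip g g)" for t
  proof -
    have expand: "ip (\<lambda>x. f x + t * g x) (\<lambda>x. p x + t * q x)
      = ip f p + t * (ip f q + ip g p) + t\<^sup>2 * ip g q" for p q
      by (simp add: ip_add_scale)
        (simp add: ip_commute[of "\<lambda>x. f x + t * g x"] ip_add_scale ip_commute[of p] ip_commute[of q]
          power2_eq_square algebra_simps)
    have "\<theta> * (ip f f + t * (ip f g + ip g f) + t\<^sup>2 * ip g g)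
      \<le> ip f (ap f) + t * (ip f (ap g) + ip g (ap f)) + t\<^sup>2 * ip g (ap g)"
      using low[of t] unfolding Q_def ap_add_scale expand .
    moreover have "ip f (ap f) = \<theta>" by (simp add: \<theta>_def Q_def)
    moreover have "ip f (ap g) = ip g g + \<theta> * ip f g" using norm_g by simp
    ultimately show ?thesis
      unfolding fg f1(2) ip_commute[of g f] by (simp add: Q_def algebra_simps)
  qed
  then have "ip g g = 0"
    using ip_self_nonneg by (rule quadratic_nonneg_imp_zero)
  then have "ap f = (\<lambda>x. \<theta> * f x)"
    using f1(1) supported_ap[of f] by (auto simp: ip_self_eq_0 g_def supported_def fun_eq_iff)
  with f1 show ?thesis by blast
qed

definition orthonormal :: "('a \<Rightarrow> real) set \<Rightarrow> bool" where
  "orthonormal S \<longleftrightarrow> finite S \<and> (\<forall>u\<in>S. supported u) \<and>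
     (\<forall>u\<in>S. \<forall>w\<in>S. ip u w = (if u = w then 1 else 0))"

lemma sum_indicator:
  assumes "x \<in> V"
  shows "(\<Sum>y\<in>V. (if y = x then 1 else 0) * f y) = (f x :: real)"
  using assms finite_V by (simp add: if_distrib[of "\<lambda>c. c * _"] cong: if_cong)

text \<open>Here \<open>h\<close> is the indicator of \<open>x\<close> minus its orthogonal
  projection onto the span of \<open>S\<close>. Its norm yields Bessel's inequality, its vanishing
  yields completeness.\<close>

lemma orthonormal_residual:
  assumes S: "orthonormal S" and x: "x \<in> V"
  defines "h \<equiv> \<lambda>y. (if y = x then 1 else 0) - (\<Sum>u\<in>S. u x * u y)"
  shows "supported h" "w \<in> S \<Longrightarrow> ip w h = 0" "ip h h = 1 - (\<Sum>u\<in>S. (u x)\<^sup>2)"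
proof -
  show "supported h"
    using S x by (auto simp: supported_def h_def orthonormal_def intro!: sum.neutral)
  have delta: "(\<Sum>y\<in>V. (if y = x then 1 else 0) * f y) = f x" for f :: "'a \<Rightarrow> real"
    using x by (rule sum_indicator)
  have ip_h: "ip f h = f x - (\<Sum>u\<in>S. u x * ip f u)" for f
  proof -
    have "ip f h = (\<Sum>y\<in>V. (if y = x then 1 else 0) * f y) - (\<Sum>y\<in>V. \<Sum>u\<in>S. u x * (f y * u y))"
      by (simp add: ip_def h_def right_diff_distrib sum_subtractf sum_distrib_left mult.commute
          mult.left_commute)
    also have "(\<Sum>y\<in>V. \<Sum>u\<in>S. u x * (f y * u y)) = (\<Sum>u\<in>S. u x * ip f u)"
      by (subst sum.swap) (simp add: ip_def sum_distrib_left)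
    finally show ?thesis by (simp add: delta)
  qed
  have orth: "ip w h = 0" if "w \<in> S" for w
  proof -
    have "(\<Sum>u\<in>S. u x * ip w u) = (\<Sum>u\<in>S. if u = w then u x else 0)"
      using S that by (intro sum.cong) (auto simp: orthonormal_def)
    also have "\<dots> = w x" using S that by (simp add: orthonormal_def)
    finally show ?thesis by (simp add: ip_h)
  qed
  then show "w \<in> S \<Longrightarrow> ip w h = 0" .
  have "ip h h = h x - (\<Sum>u\<in>S. u x * ip h u)" by (rule ip_h)
  also have "(\<Sum>u\<in>S. u x * ip h u) = 0"
    using orth by (simp add: ip_commute)
  finally show "ip h h = 1 - (\<Sum>u\<in>S. (u x)\<^sup>2)"
    by (simp add: h_def power2_eq_square)
qed

text \<open>Bessel's inequality for the indicators of all points, summed over \<open>V\<close>,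
  counts every element of \<open>S\<close> once; no notion of dimension is involved.\<close>

lemma card_orthonormal_le:
  assumes S: "orthonormal S"
  shows "card S \<le> card V"
proof -
  have "real (card S) = (\<Sum>u\<in>S. ip u u)"
    using S by (simp add: orthonormal_def)
  also have "\<dots> = (\<Sum>x\<in>V. \<Sum>u\<in>S. (u x)\<^sup>2)"
    unfolding ip_def power2_eq_square by (rule sum.swap)
  also have "\<dots> \<le> (\<Sum>x\<in>V. 1)"
  proof (rule sum_mono)
    fix x assume "x \<in> V"
    have "0 \<le> 1 - (\<Sum>u\<in>S. (u x)\<^sup>2)"
      unfolding orthonormal_residual(3)[OF S \<open>x \<in> V\<close>, symmetric] by (rule ip_self_nonneg)
    then show "(\<Sum>u\<in>S. (u x)\<^sup>2) \<le> 1" by simp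
  qed
  finally show ?thesis by simp
qed

text \<open>A largest orthonormal set of eigenfunctions exists by the cardinality bound. A nonzero
  residual of an indicator would allow one more eigenfunction, so all residuals vanish; this is the
  last property.\<close>

theorem spectral:
  obtains U \<theta> where "finite U"
    "\<And>u w. \<lbrakk>u \<in> U; w \<in> U\<rbrakk> \<Longrightarrow> (\<Sum>x\<in>V. u x * w x) = (if u = w then 1 else 0)"
    "\<And>u x. \<lbrakk>u \<in> U; x \<in> V\<rbrakk> \<Longrightarrow> (\<Sum>y\<in>V. a x y * u y) = \<theta> u * u x"
    "\<And>x y. \<lbrakk>x \<in> V; y \<in> V\<rbrakk> \<Longrightarrow> (\<Sum>u\<in>U. u x * u y) = (if x = y then 1 else 0)"
proof -
  define P where "P S \<longleftrightarrow> orthonormal S \<and> (\<forall>u\<in>S. \<exists>c. ap u = (\<lambda>x. c * u x))" for S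
  have "P {}" by (simp add: P_def orthonormal_def)
  moreover have "\<forall>S. P S \<longrightarrow> card S < Suc (card V)"
    using card_orthonormal_le by (simp add: P_def less_Suc_eq_le)
  ultimately obtain U where U: "P U" and max: "\<And>S. P S \<Longrightarrow> card S \<le> card U"
    using ex_has_greatest_nat[of P "{}" card "Suc (card V)"] by blast
  have on: "orthonormal U" and eig: "\<And>u. u \<in> U \<Longrightarrow> \<exists>c. ap u = (\<lambda>x. c * u x)"
    using U by (auto simp: P_def)
  have complete: "ip h h = 0" if h: "supported h" "\<And>u. u \<in> U \<Longrightarrow> ip u h = 0" for h
  proof (rule ccontr)
    assume "ip h h \<noteq> 0"
    from ex_orthogonal_eigenfunction[OF eig h this] obtain f where
      f: "supported f" "\<And>u. u \<in> U \<Longrightarrow> ip u f = 0" "ip f f = 1" "\<exists>c. ap f = (\<lambda>x. c * f x)"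
      by blast
    then have "f \<notin> U" by fastforce
    have fu: "ip f u = 0" if "u \<in> U" for u
      using f(2)[OF that] ip_commute by metis
    have "orthonormal (insert f U)"
      using on f(1-3) fu \<open>f \<notin> U\<close> by (auto simp: orthonormal_def)
    then have "P (insert f U)"
      unfolding P_def using eig f(4) by blast
    then show False
      using max[of "insert f U"] on \<open>f \<notin> U\<close> by (simp add: orthonormal_def)
  qed
  define \<theta> where "\<theta> u = (SOME c. ap u = (\<lambda>x. c * u x))" for u
  have \<theta>: "ap u = (\<lambda>x. \<theta> u * u x)" if "u \<in> U" for u
    unfolding \<theta>_def using eig[OF that] by (rule someI_ex)
  show ?thesis
  proof
    show "finite U" using on by (simp add: orthonormal_def)
    show "(\<Sum>x\<in>V. u x * w x) = (if u = w then 1 else 0)" if "u \<in> U" "w \<in> U" for u w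
      using on that by (simp add: orthonormal_def ip_def)
    show "(\<Sum>y\<in>V. a x y * u y) = \<theta> u * u x" if "u \<in> U" "x \<in> V" for u x
      using fun_cong[OF \<theta>[OF that(1)], of x] that(2) by (simp add: ap_def)
    show "(\<Sum>u\<in>U. u x * u y) = (if x = y then 1 else 0)" if "x \<in> V" "y \<in> V" for x y
    proof -
      have "ip (\<lambda>y. (if y = x then 1 else 0) - (\<Sum>u\<in>U. u x * u y))
          (\<lambda>y. (if y = x then 1 else 0) - (\<Sum>u\<in>U. u x * u y)) = 0"
        using orthonormal_residual(1,2)[OF on that(1)] by (rule complete)
      with that(2) show ?thesis by (simp add: ip_self_eq_0 eq_commute[of x y])
    qed
  qed
qed

end

text \<open>Gaussian elimination with pivot \<open>p\<close> in equation \<open>i\<close>. It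
  replaces rank arguments twice: for the incidences of lines with vertices, and in Godsil's
  bound.\<close>

lemma ex_nontrivial_solution:
  fixes \<phi> :: "'i \<Rightarrow> 'z \<Rightarrow> real"
  assumes "finite I" "finite Z" "card I < card Z"
  shows "\<exists>c. (\<exists>z\<in>Z. c z \<noteq> 0) \<and> (\<forall>i\<in>I. (\<Sum>z\<in>Z. c z * \<phi> i z) = 0)"
  using assms
proof (induction I arbitrary: Z \<phi> rule: finite_induct)
  case empty
  then show ?case by (intro exI[of _ "\<lambda>_. 1"]) (auto simp: card_gt_0_iff)
next
  case (insert i I)
  show ?case
  proof (cases "\<forall>z\<in>Z. \<phi> i z = 0")
    case True
    have "card I < card Z" using insert by simp
    from insert.IH[OF \<open>finite Z\<close> this, of \<phi>] True show ?thesis by auto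
  next
    case False
    then obtain p where p: "p \<in> Z" "\<phi> i p \<noteq> 0" by blast
    define Z' where "Z' = Z - {p}"
    define \<psi> where "\<psi> = (\<lambda>j z. \<phi> j z - \<phi> i z / \<phi> i p * \<phi> j p)"
    have "finite Z'" "card I < card Z'"
      using insert p by (auto simp: Z'_def)
    from insert.IH[OF this, of \<psi>] obtain c where
      c: "\<exists>z\<in>Z'. c z \<noteq> 0" "\<forall>j\<in>I. (\<Sum>z\<in>Z'. c z * \<psi> j z) = 0" by blast
    define r where "r = - (\<Sum>z\<in>Z'. c z * \<phi> i z) / \<phi> i p"
    define c' where "c' = c(p := r)"
    have split: "(\<Sum>z\<in>Z. c' z * \<phi> j z) = r * \<phi> j p + (\<Sum>z\<in>Z'. c z * \<phi> j z)" for j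
    proof -
      have "(\<Sum>z\<in>Z. c' z * \<phi> j z) = c' p * \<phi> j p + (\<Sum>z\<in>Z'. c' z * \<phi> j z)"
        unfolding Z'_def using insert.prems(1) p(1) by (rule sum.remove)
      also have "(\<Sum>z\<in>Z'. c' z * \<phi> j z) = (\<Sum>z\<in>Z'. c z * \<phi> j z)"
        by (rule sum.cong) (auto simp: c'_def Z'_def)
      finally show ?thesis by (simp add: c'_def)
    qed
    have "(\<Sum>z\<in>Z. c' z * \<phi> i z) = 0"
      using p(2) by (simp add: split r_def)
    moreover have "(\<Sum>z\<in>Z. c' z * \<phi> j z) = 0" if "j \<in> I" for j
    proof -
      have "(\<Sum>z\<in>Z'. c z * \<psi> j z)
        = (\<Sum>z\<in>Z'. c z * \<phi> j z) - (\<Sum>z\<in>Z'. c z * \<phi> i z) / \<phi> i p * \<phi> j p"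
        by (simp add: \<psi>_def right_diff_distrib sum_subtractf sum_divide_distrib sum_distrib_right
            mult.assoc)
      with c(2) that show ?thesis by (simp add: split r_def)
    qed
    moreover have "\<exists>z\<in>Z. c' z \<noteq> 0"
      using c(1) by (auto simp: c'_def Z'_def)
    ultimately show ?thesis by blast
  qed
qed

section \<open>Lines in locally claw-bounded graphs\<close>

locale finite_graph =
  fixes V :: "'a set" and adj :: "'a \<Rightarrow> 'a \<Rightarrow> bool"
  assumes finite_V: "finite V"
    and adj_sym: "adj x y \<Longrightarrow> adj y x"
    and adj_irrefl: "\<not> adj x x"
    and adj_in_V: "adj x y \<Longrightarrow> x \<in> V"
begin

definition nbs :: "'a \<Rightarrow> 'a set" where
  "nbs x = {y. adj x y}"

definition independent :: "'a set \<Rightarrow> bool" where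
  "independent S \<longleftrightarrow> (\<forall>x\<in>S. \<forall>y\<in>S. \<not> adj x y)"

definition is_clique :: "'a set \<Rightarrow> bool" where
  "is_clique C \<longleftrightarrow> C \<subseteq> V \<and> (\<forall>x\<in>C. \<forall>y\<in>C. x \<noteq> y \<longrightarrow> adj x y)"

lemma adj_commute: "adj x y \<longleftrightarrow> adj y x"
  using adj_sym by blast

lemma nbs_subset: "nbs x \<subseteq> V"
  using adj_in_V adj_sym by (auto simp: nbs_def)

lemma finite_nbs [simp]: "finite (nbs x)"
  using nbs_subset finite_V by (rule finite_subset)

lemma in_nbs [simp]: "y \<in> nbs x \<longleftrightarrow> adj x y"
  by (simp add: nbs_def)

lemma finite_is_clique: "is_clique C \<Longrightarrow> finite C"
  using finite_V finite_subset by (auto simp: is_clique_def)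

lemma ex_largest_independent:
  obtains S where "S \<subseteq> nbs x" "independent S"
    "\<And>T. T \<subseteq> nbs x \<Longrightarrow> independent T \<Longrightarrow> card T \<le> card S"
proof -
  have "\<exists>S. (S \<subseteq> nbs x \<and> independent S) \<and>
      (\<forall>T. T \<subseteq> nbs x \<and> independent T \<longrightarrow> card T \<le> card S)"
    by (rule ex_has_greatest_nat[of _ "{}" _ "Suc (card (nbs x))"])
      (auto simp: independent_def less_Suc_eq_le intro: card_mono)
  then show ?thesis using that by blast
qed

lemma independent_insert:
  "independent (insert v S) \<longleftrightarrow> independent S \<and> (\<forall>u\<in>S. \<not> adj u v)"
  using adj_irrefl by (auto simp: independent_def adj_commute)

end

text \<open>
  Here \<open>l\<close> and \<open>m\<close> play the roles of $\lambda = a_1$ and $\mu = c_2$.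
\<close>

locale claw_bounded_graph = finite_graph +
  fixes k l m q :: nat
  assumes degree: "x \<in> V \<Longrightarrow> card (nbs x) = k"
    and common_adj: "adj x y \<Longrightarrow> card (nbs x \<inter> nbs y) = l"
    and common_nonadj: "\<lbrakk>x \<in> V; y \<in> V; x \<noteq> y; \<not> adj x y\<rbrakk> \<Longrightarrow> card (nbs x \<inter> nbs y) \<le> m"
    and claw: "\<lbrakk>x \<in> V; S \<subseteq> nbs x; independent S\<rbrakk> \<Longrightarrow> card S \<le> q"
begin

text \<open>A largest independent set in the neighbourhood of \<open>x\<close> dominates it, and
  each of its at most \<open>q\<close> points covers itself and \<open>l\<close> others.\<close>

lemma degree_le:
  assumes x: "x \<in> V"
  shows "k \<le> q * (l + 1)"
proof -
  obtain S where S: "S \<subseteq> nbs x" "independent S"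
    and max: "\<And>T. T \<subseteq> nbs x \<Longrightarrow> independent T \<Longrightarrow> card T \<le> card S"
    by (rule ex_largest_independent[of x]) (rule that)
  have fin: "finite S" using S(1) finite_nbs by (rule finite_subset)
  have "nbs x \<subseteq> (\<Union>p\<in>S. insert p (nbs x \<inter> nbs p))"
  proof
    fix y assume y: "y \<in> nbs x"
    show "y \<in> (\<Union>p\<in>S. insert p (nbs x \<inter> nbs p))"
    proof (rule ccontr)
      assume no: "y \<notin> (\<Union>p\<in>S. insert p (nbs x \<inter> nbs p))"
      then have "y \<notin> S" by auto
      moreover have "independent (insert y S)"
        using no y S by (auto simp: independent_insert)
      ultimately show False using max[of "insert y S"] y S fin by simp
    qed
  qed
  then have "card (nbs x) \<le> card (\<Union>p\<in>S. insert p (nbs x \<inter> nbs p))"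
    by (rule card_mono[rotated]) (use fin in auto)
  also have "\<dots> \<le> (\<Sum>p\<in>S. card (insert p (nbs x \<inter> nbs p)))"
    by (rule card_UN_le[OF fin])
  also have "\<dots> \<le> (\<Sum>p\<in>S. l + 1)"
  proof (rule sum_mono)
    fix p assume "p \<in> S"
    then have "card (nbs x \<inter> nbs p) = l" using S(1) common_adj by auto
    then show "card (insert p (nbs x \<inter> nbs p)) \<le> l + 1"
      using card_insert_le_m1[of "l + 1"] by (simp add: card_insert_if)
  qed
  also have "\<dots> \<le> q * (l + 1)"
    using mult_le_mono1[OF claw[OF x S], of "l + 1"] by simp
  finally show ?thesis using degree[OF x] by simp
qed

end

section \<open>Lines when \<lambda> is large compared with \<mu>\<close>

locale claw_bounded_large = claw_bounded_graph +
  assumes m_pos: "m \<ge> 1" and q_pos: "q \<ge> 1"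
    and l_large: "2 * q * (q + 1) * m \<le> l"
begin

text \<open>The forms in which \<open>l_large\<close> is used. The first makes lines sharing two
  points coincide and leaves room on a line for a further independent point, the second gives lines
  more than \<open>q + 1\<close> points, the third fixes the number of lines at a vertex.\<close>

lemma l_bounds: "2 * m + 2 * (q * m) \<le> l" "q + 1 + q * m \<le> l" "(q + 1) * q * m \<le> l"
proof -
  have l: "2 * (q * q * m) + 2 * (q * m) \<le> l"
    using l_large by (simp add: algebra_simps)
  have "1 * m \<le> q * q * m" "q * 1 \<le> q * (q * m)" "1 * 1 \<le> q * m"
    using m_pos q_pos by (intro mult_le_mono; simp)+
  then have "m \<le> q * q * m" "q \<le> q * q * m" "1 \<le> q * m"
    by (simp_all add: mult.assoc)
  moreover have "(q + 1) * q * m = q * q * m + q * m"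
    by (simp add: algebra_simps)
  ultimately show "2 * m + 2 * (q * m) \<le> l" "q + 1 + q * m \<le> l" "(q + 1) * q * m \<le> l"
    using l by linarith+
qed

text \<open>A clique containing an edge has at most \<open>l + 2\<close> points, and a loss of
  \<open>q * m\<close> is tolerated; the sum avoids truncated subtraction. Maximality is phrased by
  non-neighbours because \<open>card_nbs_line\<close> needs such a \<open>z\<close>.\<close>

definition line :: "'a set \<Rightarrow> bool" where
  "line L \<longleftrightarrow> is_clique L \<and> l + 2 \<le> card L + q * m \<and> (\<forall>v\<in>V - L. \<exists>z\<in>L. \<not> adj v z)"

definition lines_at :: "'a \<Rightarrow> 'a set set" where
  "lines_at x = {L. line L \<and> x \<in> L}"

lemma in_lines_at [simp]: "L \<in> lines_at x \<longleftrightarrow> line L \<and> x \<in> L"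
  by (simp add: lines_at_def)

lemma finite_line: "line L \<Longrightarrow> finite L"
  by (simp add: line_def finite_is_clique)

lemma line_subset: "line L \<Longrightarrow> L \<subseteq> V"
  by (simp add: line_def is_clique_def)

lemma line_adj: "\<lbrakk>line L; x \<in> L; y \<in> L; x \<noteq> y\<rbrakk> \<Longrightarrow> adj x y"
  by (simp add: line_def is_clique_def)

lemma line_card_gt: "line L \<Longrightarrow> q + 1 < card L"
  using l_bounds(2) by (simp add: line_def)

lemma finite_lines: "finite {L. line L}"
  by (rule finite_subset[of _ "Pow V"]) (use finite_V line_subset in auto)

lemma finite_lines_at [simp]: "finite (lines_at x)"
  by (rule finite_subset[OF _ finite_lines]) (auto simp: lines_at_def)

text \<open>Some \<open>z\<close> on the line is not adjacent to \<open>y\<close>, and every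
  neighbour of \<open>y\<close> on the line is a common neighbour of \<open>y\<close> and
  \<open>z\<close>.\<close>

lemma card_nbs_line:
  assumes L: "line L" and y: "y \<in> V" "y \<notin> L"
  shows "card (nbs y \<inter> L) \<le> m"
proof -
  obtain z where z: "z \<in> L" "\<not> adj y z" using L y by (auto simp: line_def)
  have "nbs y \<inter> L \<subseteq> nbs y \<inter> nbs z"
    using line_adj[OF L z(1)] z(2) by (metis Int_iff in_nbs subsetI)
  then have "card (nbs y \<inter> L) \<le> card (nbs y \<inter> nbs z)"
    by (rule card_mono[rotated]) simp
  also have "\<dots> \<le> m"
    using z y line_subset[OF L] by (intro common_nonadj) auto
  finally show ?thesis .
qed

text \<open>Distinct lines share at most \<open>m\<close> points, while their union lies in an edge
  and its \<open>l\<close> common neighbours. Inclusion-exclusion gives 2(l + 2 - qm) \<le> l + 2 +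
  m, which contradicts the first bound on \<open>l\<close>.\<close>

lemma line_unique:
  assumes L: "line L" "line L'" and xy: "x \<in> L \<inter> L'" "y \<in> L \<inter> L'" "x \<noteq> y"
  shows "L = L'"
proof (rule ccontr)
  assume ne: "L \<noteq> L'"
  have "\<not> L' \<subseteq> L"
  proof
    assume sub: "L' \<subseteq> L"
    then obtain c where c: "c \<in> L" "c \<notin> L'" using ne by blast
    have "c \<in> V - L'" using c line_subset[OF L(1)] by blast
    with L(2) obtain z where "z \<in> L'" "\<not> adj c z"
      unfolding line_def by blast
    then show False using c sub line_adj[OF L(1)] by blast
  qed
  then obtain c where c: "c \<in> L'" "c \<notin> L" by blast
  have fin: "finite L" "finite L'" using L finite_line by auto
  have "L \<inter> L' \<subseteq> nbs c \<inter> L"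
    using c line_adj[OF L(2)] by (metis IntD1 IntD2 IntI in_nbs subsetI)
  then have "card (L \<inter> L') \<le> card (nbs c \<inter> L)"
    by (rule card_mono[rotated]) simp
  also have "\<dots> \<le> m" using card_nbs_line[OF L(1)] c line_subset[OF L(2)] by blast
  finally have inter: "card (L \<inter> L') \<le> m" .
  have "adj x y" using xy line_adj[OF L(1)] by blast
  have "L \<union> L' \<subseteq> {x, y} \<union> (nbs x \<inter> nbs y)"
  proof
    fix z assume "z \<in> L \<union> L'"
    then show "z \<in> {x, y} \<union> (nbs x \<inter> nbs y)"
      using xy line_adj[OF L(1), of x z] line_adj[OF L(1), of y z] line_adj[OF L(2), of x z]
        line_adj[OF L(2), of y z] by (cases "z = x \<or> z = y") auto
  qed
  then have "card (L \<union> L') \<le> card ({x, y} \<union> (nbs x \<inter> nbs y))"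
    by (rule card_mono[rotated]) simp
  also have "\<dots> \<le> card {x, y} + card (nbs x \<inter> nbs y)" by (rule card_Un_le)
  also have "\<dots> = l + 2" using common_adj[OF \<open>adj x y\<close>] xy(3) by simp
  finally have "card (L \<union> L') \<le> l + 2" .
  moreover have "card L + card L' = card (L \<union> L') + card (L \<inter> L')"
    by (rule card_Un_Int[OF fin])
  moreover have "l + 2 \<le> card L + q * m" "l + 2 \<le> card L' + q * m"
    using L by (auto simp: line_def)
  ultimately show False using inter l_bounds(1) m_pos by linarith
qed

lemma is_clique_imp_line:
  assumes C: "is_clique C" "l + 2 \<le> card C + q * m"
  obtains L where "line L" "C \<subseteq> L"
proof -
  define A where "A = {C'. is_clique C' \<and> C \<subseteq> C'}"
  have finA: "finite A"
    by (rule finite_subset[of _ "Pow V"]) (use finite_V in \<open>auto simp: A_def is_clique_def\<close>)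
  have "C \<in> A" using C by (simp add: A_def)
  from finite_has_maximal2[OF finA this] obtain L
    where L: "L \<in> A" "\<forall>L'\<in>A. L \<subseteq> L' \<longrightarrow> L = L'" by auto
  have clique: "is_clique L" "C \<subseteq> L" using L(1) by (auto simp: A_def)
  have "\<exists>z\<in>L. \<not> adj v z" if v: "v \<in> V - L" for v
  proof (rule ccontr)
    assume "\<not> ?thesis"
    then have "\<And>z. z \<in> L \<Longrightarrow> adj v z" by blast
    then have "is_clique (insert v L)"
      using v clique(1) adj_sym unfolding is_clique_def by (metis DiffE insertE insert_subset)
    then have "insert v L \<in> A" using clique by (auto simp: A_def)
    then show False using L(2) v by blast
  qed
  moreover have "card C \<le> card L"
    using clique finite_is_clique by (simp add: card_mono)
  ultimately have "line L" using clique C(2) by (auto simp: line_def)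
  then show ?thesis using that clique by blast
qed

text \<open>Let \<open>Y\<close> be the common neighbours of \<open>x\<close> and \<open>p\<close>
  adjacent to no other point of \<open>S\<close>. Two non-adjacent points of \<open>Y\<close> could
  replace \<open>p\<close> and enlarge \<open>S\<close>, so \<open>Y\<close> is a clique. Each of
  the other points of \<open>S\<close> removes at most \<open>m\<close> of the \<open>l\<close>
  common neighbours.\<close>

lemma largest_independent_in_line:
  assumes x: "x \<in> V" and S: "S \<subseteq> nbs x" "independent S"
    and max: "\<And>T. T \<subseteq> nbs x \<Longrightarrow> independent T \<Longrightarrow> card T \<le> card S"
    and p: "p \<in> S"
  shows "\<exists>L. line L \<and> x \<in> L \<and> p \<in> L"
proof -
  have fin: "finite S" using S(1) finite_nbs by (rule finite_subset)
  define Y where "Y = {z \<in> nbs x \<inter> nbs p. \<forall>p'\<in>S - {p}. \<not> adj z p'}"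
  have finY: "finite Y"
    by (rule finite_subset[of _ "nbs x"]) (auto simp: Y_def)
  have xp: "adj x p" using p S(1) by auto
  have "is_clique (insert x (insert p Y))"
  proof -
    have "adj z z'" if z: "z \<in> Y" "z' \<in> Y" "z \<noteq> z'" for z z'
    proof (rule ccontr)
      assume na: "\<not> adj z z'"
      define T where "T = insert z (insert z' (S - {p}))"
      have "z \<notin> S" "z' \<notin> S"
        using z p S(2) by (auto simp: Y_def independent_def)
      then have "card T = Suc (card S)"
        using z fin card_Suc_Diff1[OF fin p] by (simp add: T_def)
      moreover have "T \<subseteq> nbs x" using z S by (auto simp: T_def Y_def)
      moreover have "independent T"
      proof -
        have "independent (S - {p})" using S(2) by (auto simp: independent_def)
        then show ?thesis
          using z na unfolding T_def independent_insert by (auto simp: Y_def adj_commute)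
      qed
      ultimately show False using max[of T] by simp
    qed
    moreover have "adj x z" "adj p z" if "z \<in> Y" for z using that by (auto simp: Y_def)
    moreover have "Y \<subseteq> V" using nbs_subset[of x] unfolding Y_def by blast
    ultimately show ?thesis
      using x xp adj_in_V[OF adj_sym[OF xp]] adj_sym by (auto simp: is_clique_def)
  qed
  moreover have "l + 2 \<le> card (insert x (insert p Y)) + q * m"
  proof -
    have "nbs x \<inter> nbs p \<subseteq> Y \<union> (\<Union>p'\<in>S - {p}. nbs p \<inter> nbs p')"
      by (auto simp: Y_def adj_commute)
    then have "card (nbs x \<inter> nbs p) \<le> card (Y \<union> (\<Union>p'\<in>S - {p}. nbs p \<inter> nbs p'))"
      by (rule card_mono[rotated]) (use fin finY in auto)
    also have "\<dots> \<le> card Y + card (\<Union>p'\<in>S - {p}. nbs p \<inter> nbs p')"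
      by (rule card_Un_le)
    also have "card (\<Union>p'\<in>S - {p}. nbs p \<inter> nbs p') \<le> (\<Sum>p'\<in>S - {p}. card (nbs p \<inter> nbs p'))"
      using fin by (intro card_UN_le) simp
    also have "\<dots> \<le> (\<Sum>p'\<in>S - {p}. m)"
    proof (rule sum_mono)
      fix p' assume p': "p' \<in> S - {p}"
      moreover have "S \<subseteq> V" using S(1) nbs_subset by (rule subset_trans)
      ultimately show "card (nbs p \<inter> nbs p') \<le> m"
        using p S(2) by (intro common_nonadj) (auto simp: independent_def)
    qed
    also have "\<dots> \<le> q * m"
    proof -
      have "card (S - {p}) \<le> card S" using fin by (simp add: card_Diff1_le)
      also have "\<dots> \<le> q" using claw[OF x S] .
      finally show ?thesis by simp
    qed
    finally have "l \<le> card Y + q * m" using common_adj[OF xp] by simp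
    moreover have "x \<noteq> p" "x \<notin> Y" "p \<notin> Y" using xp adj_irrefl by (auto simp: Y_def)
    ultimately show ?thesis using finY by simp
  qed
  ultimately show ?thesis using is_clique_imp_line by (metis insert_subset)
qed

text \<open>
  Otherwise \<open>y\<close> could be extended, one line at a time, to an independent set that meets all the
  lines through the points of a largest independent set.
\<close>

lemma adj_in_line:
  assumes xy: "adj x y"
  shows "\<exists>L. line L \<and> x \<in> L \<and> y \<in> L"
proof (rule ccontr)
  assume no_line: "\<not> ?thesis"
  have x: "x \<in> V" using xy by (rule adj_in_V)
  obtain S where S: "S \<subseteq> nbs x" "independent S"
    and max: "\<And>T. T \<subseteq> nbs x \<Longrightarrow> independent T \<Longrightarrow> card T \<le> card S"
    by (rule ex_largest_independent[of x]) (rule that)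
  have fin: "finite S" using S(1) finite_nbs by (rule finite_subset)
  have "\<forall>p\<in>S. \<exists>L. line L \<and> x \<in> L \<and> p \<in> L"
    using largest_independent_in_line[OF x S max] by blast
  then obtain L where L: "\<And>p. p \<in> S \<Longrightarrow> line (L p)" "\<And>p. p \<in> S \<Longrightarrow> x \<in> L p"
    "\<And>p. p \<in> S \<Longrightarrow> p \<in> L p"
    by metis
  have "\<exists>I. I \<subseteq> nbs x \<and> independent I \<and> card I = card T + 1 \<and> I \<subseteq> {y} \<union> (\<Union>p\<in>T. L p)"
    if "finite T" "T \<subseteq> S" for T
    using that
  proof (induction T rule: finite_induct)
    case empty
    show ?case using xy adj_irrefl by (intro exI[of _ "{y}"]) (simp add: independent_def)
  next
    case (insert p T)
    then obtain I where I: "I \<subseteq> nbs x" "independent I" "card I = card T + 1"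
      "I \<subseteq> {y} \<union> (\<Union>p\<in>T. L p)" by blast
    have finI: "finite I" using I(1) finite_nbs by (rule finite_subset)
    have pS: "p \<in> S" using insert by simp
    note Lp = L(1)[OF pS] L(2)[OF pS] L(3)[OF pS]
    \<comment> \<open>Such an \<open>i\<close> would put \<open>p\<close> and an earlier
      \<open>p'\<close> on one line, making two points of the independent set \<open>S\<close>
      adjacent; \<open>y\<close> itself lies on no line with \<open>x\<close>.\<close>
    have I_Lp: "i \<notin> L p" if i: "i \<in> I" for i
    proof
      assume iL: "i \<in> L p"
      have xi: "adj x i" using i I by auto
      have "i \<noteq> y" using iL no_line Lp by blast
      then obtain p' where p': "p' \<in> T" "i \<in> L p'" using i I(4) by blast
      have p'S: "p' \<in> S" "p' \<noteq> p" using p' insert by auto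
      have "x \<noteq> i" using xi adj_irrefl by auto
      then have "L p = L p'"
        using line_unique[OF Lp(1) L(1)[OF p'S(1)], of x i] iL p' Lp L p'S by blast
      then have "adj p p'" using line_adj[OF Lp(1)] Lp L(3)[OF p'S(1)] p'S by auto
      then show False using S(2) pS p'S by (auto simp: independent_def)
    qed
    \<comment> \<open>At most \<open>q\<close> points of \<open>I\<close> have at most
      \<open>m\<close> neighbours each on this line, and \<open>x\<close> is one more excluded
      point. The line has more than \<open>q * m + 1\<close> points, so a point to add
      remains.\<close>
    have "\<not> L p \<subseteq> insert x (\<Union>i\<in>I. nbs i \<inter> L p)"
    proof
      assume "L p \<subseteq> insert x (\<Union>i\<in>I. nbs i \<inter> L p)"
      then have "card (L p) \<le> card (insert x (\<Union>i\<in>I. nbs i \<inter> L p))"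
        by (rule card_mono[rotated]) (use finI in auto)
      also have "\<dots> \<le> Suc (card (\<Union>i\<in>I. nbs i \<inter> L p))"
        by (rule card_insert_le_m1[THEN order_trans]) auto
      also have "card (\<Union>i\<in>I. nbs i \<inter> L p) \<le> (\<Sum>i\<in>I. card (nbs i \<inter> L p))"
        by (rule card_UN_le[OF finI])
      also have "\<dots> \<le> (\<Sum>i\<in>I. m)"
        using card_nbs_line[OF Lp(1)] I_Lp I(1) nbs_subset by (intro sum_mono) blast
      also have "\<dots> \<le> q * m"
        using claw[OF x I(1,2)] by simp
      finally have "card (L p) \<le> Suc (q * m)" by simp
      moreover have "l + 2 \<le> card (L p) + q * m" using Lp by (simp add: line_def)
      ultimately show False using l_bounds(1) by linarith
    qed
    then obtain v where "v \<in> L p" "v \<notin> insert x (\<Union>i\<in>I. nbs i \<inter> L p)" by blast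
    then have v: "v \<in> L p" "v \<noteq> x" "\<And>i. i \<in> I \<Longrightarrow> \<not> adj i v" by auto
    show ?case
    proof (intro exI[of _ "insert v I"] conjI)
      show "insert v I \<subseteq> nbs x" using v I line_adj[OF Lp(1,2)] by auto
      show "independent (insert v I)" using v I by (simp add: independent_insert)
      have "v \<notin> I" using v I_Lp by blast
      then show "card (insert v I) = card (insert p T) + 1"
        using I finI insert by simp
      show "insert v I \<subseteq> {y} \<union> (\<Union>p\<in>insert p T. L p)" using v I by auto
    qed
  qed
  from this[OF fin order_refl] obtain I
    where "I \<subseteq> nbs x" "independent I" "card I = card S + 1" by blast
  then show False using max[of I] by simp
qed

section \<open>The geometry of points and lines\<close>

lemma nbs_eq_lines:
  assumes "x \<in> V"
  shows "nbs x = (\<Union>L\<in>lines_at x. L - {x})"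
  using adj_in_line line_adj adj_irrefl by fastforce

lemma lines_at_disjoint:
  "\<lbrakk>L \<in> lines_at x; L' \<in> lines_at x; L \<noteq> L'\<rbrakk> \<Longrightarrow> (L - {x}) \<inter> (L' - {x}) = {}"
  using line_unique[of L L' x] by auto

lemma sum_nbs_lines:
  fixes f :: "'a \<Rightarrow> real"
  assumes "x \<in> V"
  shows "(\<Sum>y\<in>nbs x. f y) = (\<Sum>L\<in>lines_at x. (\<Sum>y\<in>L. f y) - f x)"
proof -
  have "(\<Sum>y\<in>nbs x. f y) = (\<Sum>L\<in>lines_at x. \<Sum>y\<in>L - {x}. f y)"
    unfolding nbs_eq_lines[OF assms]
    using lines_at_disjoint finite_line by (intro sum.UNION_disjoint) auto
  also have "\<dots> = (\<Sum>L\<in>lines_at x. (\<Sum>y\<in>L. f y) - f x)"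
    using finite_line by (intro sum.cong) (auto simp: sum_diff1)
  finally show ?thesis .
qed

lemma line_card_le:
  assumes L: "line L"
  shows "card L \<le> l + 2"
proof -
  have "2 \<le> card L" using line_card_gt[OF L] q_pos by linarith
  then obtain T where "T \<subseteq> L" "card T = 2" by (meson obtain_subset_with_card_n)
  then obtain x y where xy: "x \<in> L" "y \<in> L" "x \<noteq> y" by (auto simp: card_2_iff)
  have "L \<subseteq> {x, y} \<union> (nbs x \<inter> nbs y)"
    using xy line_adj[OF L] by auto
  then have "card L \<le> card ({x, y} \<union> (nbs x \<inter> nbs y))"
    by (rule card_mono[rotated]) simp
  also have "\<dots> \<le> card {x, y} + card (nbs x \<inter> nbs y)" by (rule card_Un_le)
  also have "\<dots> = l + 2" using common_adj line_adj[OF L] xy by simp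
  finally show ?thesis .
qed

lemma degree_eq_lines:
  assumes "x \<in> V"
  shows "k = (\<Sum>L\<in>lines_at x. card L - 1)"
proof -
  have "k = card (\<Union>L\<in>lines_at x. L - {x})"
    using degree[OF assms] nbs_eq_lines[OF assms] by simp
  also have "\<dots> = (\<Sum>L\<in>lines_at x. card (L - {x}))"
    using lines_at_disjoint finite_line by (intro card_UN_disjoint) auto
  also have "\<dots> = (\<Sum>L\<in>lines_at x. card L - 1)"
    by (intro sum.cong) auto
  finally show ?thesis .
qed

lemma degree_le_lines:
  assumes "x \<in> V"
  shows "k \<le> card (lines_at x) * (l + 1)"
proof -
  have "card L - 1 \<le> l + 1" if "L \<in> lines_at x" for L
    using line_card_le[of L] that by simp
  then have "(\<Sum>L\<in>lines_at x. card L - 1) \<le> card (lines_at x) * (l + 1)"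
    using sum_bounded_above[of "lines_at x" "\<lambda>L. card L - 1" "l + 1"] by simp
  then show ?thesis using degree_eq_lines[OF assms] by simp
qed

text \<open>With t + 1 lines at \<open>x\<close>, counting neighbours gives (t + 1)(l + 1 - qm)
  \<le> t(l + 1), hence l + 1 \<le> (t + 1)qm, too small for \<open>l\<close>. It is used with t =
  q, then with t the number of lines at another vertex, which yields constancy.\<close>

lemma card_lines_at_le:
  assumes x: "x \<in> V" and t: "t \<le> q" "k \<le> t * (l + 1)"
  shows "card (lines_at x) \<le> t"
proof (rule ccontr)
  assume "\<not> ?thesis"
  then have "t + 1 \<le> card (lines_at x)" by simp
  have "l + 1 - q * m \<le> card L - 1" if "L \<in> lines_at x" for L
    using that by (auto simp: line_def)
  then have "card (lines_at x) * (l + 1 - q * m) \<le> (\<Sum>L\<in>lines_at x. card L - 1)"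
    using sum_bounded_below[of "lines_at x" "l + 1 - q * m" "\<lambda>L. card L - 1"] by simp
  with \<open>t + 1 \<le> card (lines_at x)\<close> have "(t + 1) * (l + 1 - q * m) \<le> k"
    unfolding degree_eq_lines[OF x] using mult_le_mono1 order_trans by blast
  then have "(t + 1) * (l + 1 - q * m) \<le> t * (l + 1)" using t(2) by linarith
  moreover have "(t + 1) * (l + 1) = (t + 1) * (l + 1 - q * m) + (t + 1) * (q * m)"
    using l_bounds(2) by (simp flip: add_mult_distrib2)
  moreover have "(t + 1) * (l + 1) = t * (l + 1) + (l + 1)" by simp
  moreover have "(t + 1) * (q * m) \<le> (q + 1) * (q * m)" using t(1) by (intro mult_le_mono1) simp
  moreover have "(q + 1) * (q * m) \<le> l" using l_bounds(3) by (simp only: mult.assoc)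
  ultimately show False by linarith
qed

lemma lines_at_bounded: "x \<in> V \<Longrightarrow> card (lines_at x) \<le> q"
  using degree_le card_lines_at_le by blast

lemma card_lines_at_const:
  "\<lbrakk>x \<in> V; y \<in> V\<rbrakk> \<Longrightarrow> card (lines_at x) = card (lines_at y)"
  by (intro antisym card_lines_at_le lines_at_bounded degree_le_lines)

definition num_lines_at :: nat where
  "num_lines_at = card (lines_at (SOME x. x \<in> V))"

lemma card_lines_at: "x \<in> V \<Longrightarrow> card (lines_at x) = num_lines_at"
  unfolding num_lines_at_def using card_lines_at_const some_in_eq by blast

lemma sum_nbs_lines_const:
  fixes f :: "'a \<Rightarrow> real"
  assumes "x \<in> V"
  shows "(\<Sum>y\<in>nbs x. f y) = (\<Sum>L\<in>lines_at x. \<Sum>y\<in>L. f y) - real num_lines_at * f x"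
  using card_lines_at[OF assms] by (simp add: sum_nbs_lines[OF assms] sum_subtractf)

lemma sum_lines_swap:
  fixes g :: "'a \<Rightarrow> 'a set \<Rightarrow> real"
  shows "(\<Sum>x\<in>V. \<Sum>L\<in>lines_at x. g x L) = (\<Sum>L | line L. \<Sum>x\<in>L. g x L)"
proof -
  have "(\<Sum>x\<in>V. \<Sum>L\<in>{L \<in> {L. line L}. x \<in> L}. g x L)
      = (\<Sum>L | line L. \<Sum>x\<in>{x \<in> V. x \<in> L}. g x L)"
    using finite_V finite_lines by (rule sum.swap_restrict)
  moreover have "{x \<in> V. x \<in> L} = L" if "line L" for L
    using line_subset[OF that] by auto
  ultimately show ?thesis by (simp add: lines_at_def)
qed

text \<open>The identity A + sI = N N^T for the vertex-line incidence matrix N, evaluated as a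
  quadratic form at \<open>f\<close>; it bounds all eigenvalues below by -s.\<close>

lemma sum_squares_lines:
  fixes f :: "'a \<Rightarrow> real"
  shows "(\<Sum>x\<in>V. f x * (\<Sum>y\<in>nbs x. f y)) + real num_lines_at * (\<Sum>x\<in>V. (f x)\<^sup>2)
    = (\<Sum>L | line L. (\<Sum>x\<in>L. f x)\<^sup>2)"
proof -
  have "(\<Sum>x\<in>V. f x * (\<Sum>y\<in>nbs x. f y)) + real num_lines_at * (\<Sum>x\<in>V. (f x)\<^sup>2)
      = (\<Sum>x\<in>V. \<Sum>L\<in>lines_at x. f x * (\<Sum>y\<in>L. f y))"
    by (simp add: sum_nbs_lines_const sum_distrib_left power2_eq_square algebra_simps
  flip: sum.distrib)
  also have "\<dots> = (\<Sum>L | line L. (\<Sum>x\<in>L. f x)\<^sup>2)"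
    by (simp add: sum_lines_swap power2_eq_square sum_distrib_right)
  finally show ?thesis .
qed

text \<open>Incidences counted twice: a vertex is on s \<le> q lines, and a line has at least s + 1
  points.\<close>

lemma card_lines_less:
  assumes "V \<noteq> {}"
  shows "card {L. line L} < card V"
proof -
  have "V \<noteq> {} \<Longrightarrow> num_lines_at \<le> q"
    using lines_at_bounded card_lines_at by fastforce
  then have q: "num_lines_at \<le> q" using assms by blast
  have "real (card {L. line L}) * real (num_lines_at + 1) \<le> (\<Sum>L | line L. real (card L))"
  proof (rule sum_bounded_below)
    fix L assume "L \<in> {L. line L}"
    then have "num_lines_at + 1 \<le> card L" using line_card_gt[of L] q by simp
    then show "real (num_lines_at + 1) \<le> real (card L)" by (rule of_nat_mono)
  qed
  also have "\<dots> = (\<Sum>x\<in>V. \<Sum>L\<in>lines_at x. 1)"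
    unfolding sum_lines_swap by simp
  also have "\<dots> = real (card V) * num_lines_at"
    using card_lines_at by simp
  also have "\<dots> < real (card V) * real (num_lines_at + 1)"
    using assms finite_V by (simp add: card_gt_0_iff)
  finally show ?thesis by (simp add: mult_less_cancel_right)
qed

lemma ex_vanishing_on_lines:
  assumes "V \<noteq> {}"
  obtains f :: "'a \<Rightarrow> real" where "\<exists>x\<in>V. f x \<noteq> 0" "\<And>L. line L \<Longrightarrow> (\<Sum>x\<in>L. f x) = 0"
proof -
  from ex_nontrivial_solution[OF finite_lines finite_V card_lines_less[OF assms],
      of "\<lambda>L x. if x \<in> L then 1 else 0"]
  obtain c where c: "\<exists>x\<in>V. c x \<noteq> 0"
    "\<forall>L\<in>{L. line L}. (\<Sum>x\<in>V. c x * (if x \<in> L then 1 else (0::real))) = 0"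
    by auto
  have "(\<Sum>x\<in>L. c x) = 0" if L: "line L" for L
  proof -
    have "(\<Sum>x\<in>V. c x * (if x \<in> L then 1 else (0::real))) = (\<Sum>x\<in>V \<inter> L. c x)"
      using finite_V by (simp add: sum.inter_restrict if_distrib[of "\<lambda>r. _ * r"] cong: if_cong)
    also have "V \<inter> L = L" using line_subset[OF L] by blast
    finally show ?thesis using c(2) L by simp
  qed
  with c(1) that show ?thesis by blast
qed

end

section \<open>Eigenfunctions and walks\<close>

context finite_graph
begin

primrec walks :: "nat \<Rightarrow> 'a \<Rightarrow> 'a \<Rightarrow> nat" where
  "walks 0 x y = (if x = y then 1 else 0)"
| "walks (Suc i) x y = (\<Sum>z\<in>nbs x. walks i z y)"

lemma walks_2: "walks 2 x y = card (nbs x \<inter> nbs y)"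
proof -
  have "walks 2 x y = (\<Sum>z\<in>nbs x. if adj z y then 1 else 0)"
    by (simp add: numeral_2_eq_2)
  also have "\<dots> = card {z \<in> nbs x. adj z y}"
    by (simp add: sum.If_cases Int_def)
  also have "{z \<in> nbs x. adj z y} = nbs x \<inter> nbs y"
    by (auto simp: adj_commute)
  finally show ?thesis .
qed

text \<open>Distance two in terms of neighbourhoods, which keeps the combinatorics free of metric
  notions.\<close>

definition at_dist2 :: "'a \<Rightarrow> 'a \<Rightarrow> bool" where
  "at_dist2 x y \<longleftrightarrow> x \<noteq> y \<and> \<not> adj x y \<and> nbs x \<inter> nbs y \<noteq> {}"

definition is_eigenfunction :: "real \<Rightarrow> ('a \<Rightarrow> real) \<Rightarrow> bool" where
  "is_eigenfunction c f \<longleftrightarrow> (\<exists>x\<in>V. f x \<noteq> 0) \<and> (\<forall>x\<in>V. (\<Sum>y\<in>nbs x. f y) = c * f x)"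

lemma sum_nbs_conv:
  fixes f :: "'a \<Rightarrow> real"
  shows "(\<Sum>y\<in>nbs x. f y) = (\<Sum>y\<in>V. (if adj x y then 1 else 0) * f y)"
proof -
  have "(\<Sum>y\<in>V. (if adj x y then 1 else 0) * f y) = (\<Sum>y\<in>V. if y \<in> nbs x then f y else 0)"
    by (intro sum.cong) auto
  also have "\<dots> = (\<Sum>y\<in>V \<inter> nbs x. f y)"
    using finite_V by (simp only: sum.inter_restrict)
  also have "V \<inter> nbs x = nbs x" using nbs_subset[of x] by blast
  finally show ?thesis ..
qed

end

locale graph_spectrum = finite_graph +
  fixes U :: "('a \<Rightarrow> real) set" and \<theta> :: "('a \<Rightarrow> real) \<Rightarrow> real"
  assumes finite_U: "finite U"
    and orthonormal: "\<lbrakk>u \<in> U; w \<in> U\<rbrakk> \<Longrightarrow> (\<Sum>x\<in>V. u x * w x) = (if u = w then 1 else 0)"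
    and eigen: "\<lbrakk>u \<in> U; x \<in> V\<rbrakk> \<Longrightarrow> (\<Sum>y\<in>nbs x. u y) = \<theta> u * u x"
    and complete: "\<lbrakk>x \<in> V; y \<in> V\<rbrakk> \<Longrightarrow> (\<Sum>u\<in>U. u x * u y) = (if x = y then 1 else 0)"

lemma (in finite_graph) ex_graph_spectrum:
  obtains U \<theta> where "graph_spectrum V adj U \<theta>"
proof -
  interpret symmetric_kernel V "\<lambda>x y. if adj x y then 1 else 0"
    by unfold_locales (use finite_V adj_commute in auto)
  obtain U :: "('a \<Rightarrow> real) set" and \<theta> where "finite U"
    "\<And>u w. \<lbrakk>u \<in> U; w \<in> U\<rbrakk> \<Longrightarrow> (\<Sum>x\<in>V. u x * w x) = (if u = w then 1 else 0)"
    "\<And>u x. \<lbrakk>u \<in> U; x \<in> V\<rbrakk> \<Longrightarrow> (\<Sum>y\<in>V. (if adj x y then 1 else 0) * u y) = \<theta> u * u x"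
    "\<And>x y. \<lbrakk>x \<in> V; y \<in> V\<rbrakk> \<Longrightarrow> (\<Sum>u\<in>U. u x * u y) = (if x = y then 1 else 0)"
    by (rule spectral) (rule that)
  then have "graph_spectrum V adj U \<theta>"
    unfolding graph_spectrum_def graph_spectrum_axioms_def sum_nbs_conv
    using finite_graph_axioms by blast
  then show ?thesis by (rule that)
qed

section \<open>Expansion in an orthonormal eigenbasis\<close>

context graph_spectrum
begin

definition coef :: "('a \<Rightarrow> real) \<Rightarrow> ('a \<Rightarrow> real) \<Rightarrow> real" where
  "coef f u = (\<Sum>y\<in>V. f y * u y)"

lemma expansion:
  assumes "x \<in> V"
  shows "(\<Sum>u\<in>U. coef f u * u x) = f x"
proof -
  have "(\<Sum>u\<in>U. coef f u * u x) = (\<Sum>u\<in>U. \<Sum>y\<in>V. f y * (u y * u x))"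
    by (simp add: coef_def sum_distrib_right mult.assoc)
  also have "\<dots> = (\<Sum>y\<in>V. f y * (\<Sum>u\<in>U. u y * u x))"
    by (subst sum.swap) (simp add: sum_distrib_left)
  also have "\<dots> = (\<Sum>y\<in>V. if y = x then f y else 0)"
    using assms by (intro sum.cong) (auto simp: complete)
  also have "\<dots> = f x" using assms finite_V by simp
  finally show ?thesis .
qed

lemma sum_nbs_expansion:
  assumes "x \<in> V"
  shows "(\<Sum>y\<in>nbs x. f y) = (\<Sum>u\<in>U. \<theta> u * coef f u * u x)"
proof -
  have "(\<Sum>y\<in>nbs x. f y) = (\<Sum>y\<in>nbs x. \<Sum>u\<in>U. coef f u * u y)"
    using nbs_subset[of x] by (intro sum.cong refl) (auto simp: expansion subsetD)
  also have "\<dots> = (\<Sum>u\<in>U. coef f u * (\<Sum>y\<in>nbs x. u y))"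
    by (subst sum.swap) (simp add: sum_distrib_left)
  also have "\<dots> = (\<Sum>u\<in>U. \<theta> u * coef f u * u x)"
    using assms by (intro sum.cong) (auto simp: eigen)
  finally show ?thesis .
qed

lemma parseval: "(\<Sum>x\<in>V. (f x)\<^sup>2) = (\<Sum>u\<in>U. (coef f u)\<^sup>2)"
proof -
  have "(\<Sum>x\<in>V. (f x)\<^sup>2) = (\<Sum>x\<in>V. f x * (\<Sum>u\<in>U. coef f u * u x))"
    by (simp add: expansion power2_eq_square)
  also have "\<dots> = (\<Sum>u\<in>U. \<Sum>x\<in>V. coef f u * (f x * u x))"
    by (subst sum.swap) (simp add: sum_distrib_left mult.left_commute)
  also have "\<dots> = (\<Sum>u\<in>U. (coef f u)\<^sup>2)"
    by (simp add: coef_def power2_eq_square flip: sum_distrib_left)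
  finally show ?thesis .
qed

lemma quadratic_form: "(\<Sum>x\<in>V. f x * (\<Sum>y\<in>nbs x. f y)) = (\<Sum>u\<in>U. \<theta> u * (coef f u)\<^sup>2)"
proof -
  have "(\<Sum>x\<in>V. f x * (\<Sum>y\<in>nbs x. f y)) = (\<Sum>x\<in>V. f x * (\<Sum>u\<in>U. \<theta> u * coef f u * u x))"
    by (simp add: sum_nbs_expansion)
  also have "\<dots> = (\<Sum>u\<in>U. \<Sum>x\<in>V. \<theta> u * coef f u * (f x * u x))"
    by (subst sum.swap) (simp add: sum_distrib_left mult.left_commute)
  also have "\<dots> = (\<Sum>u\<in>U. \<theta> u * (coef f u)\<^sup>2)"
    by (simp add: coef_def power2_eq_square mult.assoc flip: sum_distrib_left)
  finally show ?thesis .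
qed

lemma eigenfunction_in_U:
  assumes u: "u \<in> U"
  shows "is_eigenfunction (\<theta> u) u"
proof -
  have "(\<Sum>x\<in>V. u x * u x) \<noteq> 0" using orthonormal[OF u u] by simp
  then obtain x where "x \<in> V" "u x * u x \<noteq> 0"
    by (rule sum.not_neutral_contains_not_neutral)
  then have "\<exists>x\<in>V. u x \<noteq> 0" by auto
  then show ?thesis using eigen[OF u] by (simp add: is_eigenfunction_def)
qed

text \<open>Symmetry of adjacency gives \<theta>(u) coef = c coef for the coefficient of
  \<open>f\<close> at each \<open>u\<close>, and some coefficient is nonzero.\<close>

lemma eigenvalue_in_U:
  assumes f: "is_eigenfunction c f"
  obtains u where "u \<in> U" "\<theta> u = c"
proof -
  have coef: "\<theta> u * coef f u = c * coef f u" if u: "u \<in> U" for u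
  proof -
    have "(\<Sum>x\<in>V. (\<Sum>y\<in>nbs x. u y) * f x) = (\<Sum>x\<in>V. \<Sum>y\<in>V. (if adj x y then 1 else 0) * u y * f x)"
      by (simp add: sum_nbs_conv sum_distrib_right)
    also have "\<dots> = (\<Sum>y\<in>V. \<Sum>x\<in>V. (if adj y x then 1 else 0) * f x * u y)"
      by (subst sum.swap) (intro sum.cong, auto simp: adj_commute)
    also have "\<dots> = (\<Sum>y\<in>V. (\<Sum>x\<in>nbs y. f x) * u y)"
      by (simp add: sum_nbs_conv sum_distrib_right)
    finally have "(\<Sum>x\<in>V. \<theta> u * u x * f x) = (\<Sum>y\<in>V. c * f y * u y)"
      using f u by (simp add: eigen is_eigenfunction_def)
    then show ?thesis by (simp add: coef_def sum_distrib_left mult_ac)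
  qed
  obtain x where x: "x \<in> V" "f x \<noteq> 0" using f by (auto simp: is_eigenfunction_def)
  then have "(\<Sum>u\<in>U. coef f u * u x) \<noteq> 0" by (simp add: expansion)
  then obtain u where u: "u \<in> U" "coef f u * u x \<noteq> 0"
    by (rule sum.not_neutral_contains_not_neutral)
  then have "\<theta> u = c" using coef[OF u(1)] by simp
  with u(1) show ?thesis by (rule that)
qed

lemma psd:
  assumes "\<And>u. u \<in> U \<Longrightarrow> - \<omega> \<le> \<theta> u"
  shows "0 \<le> (\<Sum>x\<in>V. f x * (\<Sum>y\<in>nbs x. f y)) + \<omega> * (\<Sum>x\<in>V. (f x)\<^sup>2)"
proof -
  have "0 \<le> (\<Sum>u\<in>U. (\<theta> u + \<omega>) * (coef f u)\<^sup>2)"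
  proof (intro sum_nonneg mult_nonneg_nonneg)
    show "0 \<le> \<theta> u + \<omega>" if "u \<in> U" for u using assms[OF that] by simp
  qed auto
  also have "\<dots> = (\<Sum>x\<in>V. f x * (\<Sum>y\<in>nbs x. f y)) + \<omega> * (\<Sum>x\<in>V. (f x)\<^sup>2)"
    unfolding parseval quadratic_form
    by (simp add: distrib_right sum.distrib sum_distrib_left)
  finally show ?thesis .
qed

text \<open>The star on \<open>x\<close> and \<open>S\<close> has smallest eigenvalue -sqrt s, where
  s is the size of \<open>S\<close>. Instead of interlacing, A + \<omega>I is tested on the function
  with value s at \<open>x\<close> and -\<omega> on \<open>S\<close>; the quadratic form equals
  \<omega>s(\<omega>^2 - s).\<close>

lemma card_independent_le:
  assumes low: "\<And>u. u \<in> U \<Longrightarrow> - \<omega> \<le> \<theta> u" and \<omega>: "\<omega> > 0"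
    and S: "S \<subseteq> nbs x" "independent S" and x: "x \<in> V"
  shows "real (card S) \<le> \<omega>\<^sup>2"
proof -
  define s where "s = real (card S)"
  have fin: "finite S" using S(1) finite_nbs by (rule finite_subset)
  have SV: "S \<subseteq> V" using S(1) nbs_subset by (rule subset_trans)
  have xS: "x \<notin> S" using S(1) adj_irrefl by auto
  define f where "f v = (if v = x then s else if v \<in> S then - \<omega> else 0)" for v
  have f_S: "f v = - \<omega>" if "v \<in> S" for v using that xS by (auto simp: f_def)
  have split: "(\<Sum>v\<in>V. f v * g v) = s * g x - \<omega> * (\<Sum>v\<in>S. g v)" for g
  proof -
    have "(\<Sum>v\<in>V. f v * g v) = (\<Sum>v\<in>insert x S. f v * g v)"
      using x SV finite_V by (intro sum.mono_neutral_right) (auto simp: f_def)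
    also have "\<dots> = s * g x + (\<Sum>v\<in>S. f v * g v)"
      using fin xS by (simp add: f_def)
    also have "(\<Sum>v\<in>S. f v * g v) = - \<omega> * (\<Sum>v\<in>S. g v)"
      by (simp add: f_S sum_negf sum_distrib_left)
    finally show ?thesis by simp
  qed
  have "(\<Sum>y\<in>nbs x. f y) = (\<Sum>y\<in>S. f y)"
    using S(1) adj_irrefl by (intro sum.mono_neutral_right) (auto simp: f_def)
  also have "\<dots> = - \<omega> * s" by (simp add: f_S s_def)
  finally have nx: "(\<Sum>y\<in>nbs x. f y) = - \<omega> * s" .
  have "(\<Sum>y\<in>nbs v. f y) = s" if v: "v \<in> S" for v
  proof -
    have "(\<Sum>y\<in>nbs v. f y) = (\<Sum>y\<in>nbs v. if y = x then s else 0)"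
      using S(2) v by (intro sum.cong) (auto simp: f_def independent_def)
    also have "\<dots> = s" using S(1) v adj_commute by auto
    finally show ?thesis .
  qed
  then have nS: "(\<Sum>v\<in>S. \<Sum>y\<in>nbs v. f y) = s * s" by (simp add: s_def)
  have "(\<Sum>v\<in>V. (f v)\<^sup>2) = s * s + \<omega> * \<omega> * s"
    using split[of f] xS by (simp add: power2_eq_square f_S s_def) (simp add: f_def s_def)
  then have "0 \<le> s * (- \<omega> * s) - \<omega> * (s * s) + \<omega> * (s * s + \<omega> * \<omega> * s)"
    using psd[OF low, of f] unfolding split nx nS by simp
  then have pos: "0 \<le> \<omega> * s * (\<omega>\<^sup>2 - s)"
    by (simp add: power2_eq_square algebra_simps)
  show ?thesis
  proof (cases "s = 0")
    case True
    then show ?thesis by (simp add: s_def)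
  next
    case False
    then have "0 < \<omega> * s" using \<omega> by (simp add: s_def card_gt_0_iff)
    with pos have "0 \<le> \<omega>\<^sup>2 - s"
      by (meson mult_pos_neg not_le)
    then show ?thesis by (simp add: s_def)
  qed
qed

lemma walks_spectral:
  assumes y: "y \<in> V"
  shows "x \<in> V \<Longrightarrow> real (walks i x y) = (\<Sum>u\<in>U. \<theta> u ^ i * (u x * u y))"
proof (induction i arbitrary: x)
  case 0
  then show ?case using y by (simp add: complete)
next
  case (Suc i)
  have "real (walks (Suc i) x y) = (\<Sum>z\<in>nbs x. \<Sum>u\<in>U. \<theta> u ^ i * (u z * u y))"
    using Suc.IH nbs_subset[of x] by (simp, intro sum.cong) auto
  also have "\<dots> = (\<Sum>u\<in>U. \<theta> u ^ i * (\<Sum>z\<in>nbs x. u z) * u y)"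
    by (subst sum.swap) (simp add: sum_distrib_left sum_distrib_right mult_ac)
  also have "\<dots> = (\<Sum>u\<in>U. \<theta> u ^ Suc i * (u x * u y))"
    using Suc.prems by (intro sum.cong) (auto simp: eigen)
  finally show ?case .
qed

section \<open>Spectral idempotents\<close>

definition eigenspace :: "real \<Rightarrow> ('a \<Rightarrow> real) set" where
  "eigenspace t = {u \<in> U. \<theta> u = t}"

text \<open>The kernel of the orthogonal projection onto the eigenspace of \<open>t\<close>. The set
  \<open>eigenspace t\<close> is only an orthonormal basis of that space, so its cardinality is the
  multiplicity.\<close>

definition idem :: "real \<Rightarrow> 'a \<Rightarrow> 'a \<Rightarrow> real" where
  "idem t x y = (\<Sum>u\<in>eigenspace t. u x * u y)"

lemma finite_eigenspace [simp]: "finite (eigenspace t)"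
  using finite_U by (simp add: eigenspace_def)

text \<open>
  The spectral idempotent is a polynomial in the adjacency matrix, by Lagrange interpolation.
\<close>

lemma idem_polynomial:
  obtains p :: "real poly" where
    "\<And>x y. \<lbrakk>x \<in> V; y \<in> V\<rbrakk> \<Longrightarrow> idem t x y = (\<Sum>i\<le>degree p. coeff p i * real (walks i x y))"
proof -
  define R where "R = \<theta> ` U - {t}"
  define p0 where "p0 = (\<Prod>s\<in>R. [:- s, 1:])"
  define p where "p = Polynomial.smult (inverse (poly p0 t)) p0"
  have finR: "finite R" using finite_U by (simp add: R_def)
  have p0: "poly p0 t \<noteq> 0" using finR by (auto simp: p0_def poly_prod R_def)
  have p: "poly p (\<theta> u) = (if \<theta> u = t then 1 else 0)" if "u \<in> U" for u
  proof (cases "\<theta> u = t")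
    case True
    then show ?thesis using p0 by (simp add: p_def)
  next
    case False
    then have "\<theta> u \<in> R" using that by (simp add: R_def)
    then have "poly p0 (\<theta> u) = 0" using finR by (auto simp: p0_def poly_prod)
    then show ?thesis using False by (simp add: p_def)
  qed
  have "idem t x y = (\<Sum>i\<le>degree p. coeff p i * real (walks i x y))" if "x \<in> V" "y \<in> V" for x y
  proof -
    have "(\<Sum>i\<le>degree p. coeff p i * real (walks i x y))
        = (\<Sum>i\<le>degree p. \<Sum>u\<in>U. coeff p i * \<theta> u ^ i * (u x * u y))"
      using that by (simp add: walks_spectral sum_distrib_left mult.assoc)
    also have "\<dots> = (\<Sum>u\<in>U. poly p (\<theta> u) * (u x * u y))"
      by (subst sum.swap) (simp add: poly_altdef sum_distrib_right)
    also have "\<dots> = (\<Sum>u\<in>U. if \<theta> u = t then u x * u y else 0)"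
      by (intro sum.cong) (auto simp: p)
    also have "\<dots> = idem t x y"
      unfolding idem_def eigenspace_def using finite_U
      by (intro sum.inter_filter[symmetric])
    finally show ?thesis ..
  qed
  then show ?thesis by (rule that)
qed

lemma sum_nbs_idem:
  assumes "x \<in> V"
  shows "(\<Sum>y\<in>nbs x. idem t x y) = t * idem t x x"
proof -
  have "(\<Sum>y\<in>nbs x. idem t x y) = (\<Sum>u\<in>eigenspace t. u x * (\<Sum>y\<in>nbs x. u y))"
    unfolding idem_def by (subst sum.swap) (simp add: sum_distrib_left)
  also have "\<dots> = (\<Sum>u\<in>eigenspace t. t * (u x * u x))"
    using assms by (intro sum.cong) (auto simp: eigenspace_def eigen)
  finally show ?thesis by (simp add: idem_def sum_distrib_left)
qed

lemma sum_idem_diag: "(\<Sum>x\<in>V. idem t x x) = real (card (eigenspace t))"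
  unfolding idem_def by (subst sum.swap) (simp add: eigenspace_def orthonormal)

text \<open>The idempotent is the Gram matrix of the vectors of values of the basis functions. Thus
  equality of its entries at (x,x), (y,y) and (x,y) means that all these functions agree at
  \<open>x\<close> and \<open>y\<close>.\<close>

lemma sum_diff_squares_idem:
  "(\<Sum>u\<in>eigenspace t. (u x - u y)\<^sup>2) = idem t x x + idem t y y - 2 * idem t x y"
proof -
  have "(u x - u y)\<^sup>2 = u x * u x + u y * u y - 2 * (u x * u y)" for u :: "'a \<Rightarrow> real"
    by (simp add: power2_eq_square algebra_simps)
  then show ?thesis
    by (simp add: idem_def sum.distrib sum_subtractf flip: sum_distrib_left)
qed

lemma multiplicity_bound:
  assumes degree: "\<And>x. x \<in> V \<Longrightarrow> card (nbs x) = k"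
  shows "real (card (eigenspace t)) * t\<^sup>2 \<le> real (card V) * real k"
proof -
  have "real (card (eigenspace t)) * t\<^sup>2 = (\<Sum>u\<in>eigenspace t. (\<theta> u)\<^sup>2)"
    by (simp add: eigenspace_def)
  also have "\<dots> \<le> (\<Sum>u\<in>U. (\<theta> u)\<^sup>2)"
    using finite_U by (intro sum_mono2) (auto simp: eigenspace_def)
  also have "\<dots> = (\<Sum>u\<in>U. (\<theta> u)\<^sup>2 * (\<Sum>x\<in>V. u x * u x))"
    by (simp add: orthonormal)
  also have "\<dots> = (\<Sum>x\<in>V. real (walks 2 x x))"
    by (simp add: walks_spectral sum_distrib_left) (rule sum.swap)
  also have "\<dots> = real (card V) * real k"
    by (simp add: walks_2 degree)
  finally show ?thesis .
qed

text \<open>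
  For $p(s) = (s + \omega)(s - t)$, the quadratic form of $p(A)$ at $\delta_x - \delta_w$ is $2(k - \omega t) > 0$,
  because no walk of length at most $2$ joins \<open>x\<close> and \<open>w\<close>.
\<close>

lemma ex_large_eigenvalue:
  assumes low: "\<And>u. u \<in> U \<Longrightarrow> - \<omega> \<le> \<theta> u"
    and xw: "x \<in> V" "w \<in> V" "x \<noteq> w" "\<not> adj x w" "nbs x \<inter> nbs w = {}"
    and deg: "card (nbs x) = k" "card (nbs w) = k"
    and t: "\<omega> * t < real k"
  obtains u where "u \<in> U" "u x \<noteq> u w" "t < \<theta> u"
proof -
  have sum: "(\<Sum>u\<in>U. \<theta> u ^ i * (u x - u w)\<^sup>2)
      = real (walks i x x) + real (walks i w w) - 2 * real (walks i x w)" for i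
    using xw(1,2) by (simp add: walks_spectral power2_diff sum.distrib sum_subtractf sum_distrib_left
        power2_eq_square algebra_simps)
  have "(\<Sum>u\<in>U. (\<theta> u + \<omega>) * (\<theta> u - t) * (u x - u w)\<^sup>2)
    = (\<Sum>u\<in>U. \<theta> u ^ 2 * (u x - u w)\<^sup>2) + (\<omega> - t) * (\<Sum>u\<in>U. \<theta> u ^ 1 * (u x - u w)\<^sup>2)
      - \<omega> * t * (\<Sum>u\<in>U. \<theta> u ^ 0 * (u x - u w)\<^sup>2)"
    unfolding sum_distrib_left sum.distrib[symmetric] sum_subtractf[symmetric]
    by (intro sum.cong) (auto simp: power2_eq_square algebra_simps)
  also have "\<dots> = 2 * (real k - \<omega> * t)"
    unfolding sum using xw deg adj_irrefl by (simp add: walks_2)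
  finally have "0 < (\<Sum>u\<in>U. (\<theta> u + \<omega>) * (\<theta> u - t) * (u x - u w)\<^sup>2)" using t by simp
  then obtain u where u: "u \<in> U" "0 < (\<theta> u + \<omega>) * (\<theta> u - t) * (u x - u w)\<^sup>2"
    by (meson not_le sum_nonpos)
  moreover have "0 \<le> \<theta> u + \<omega>" using low[OF u(1)] by simp
  ultimately have "u x \<noteq> u w" "t < \<theta> u"
    by (auto simp: zero_less_mult_iff)
  with u(1) show ?thesis by (rule that)
qed

end

section \<open>Bounding the valency\<close>

context finite_graph
begin

primrec ball :: "'a \<Rightarrow> nat \<Rightarrow> 'a set" where
  "ball x 0 = {x}"
| "ball x (Suc i) = ball x i \<union> (\<Union>y\<in>ball x i. nbs y)"

lemma ball_Suc_adj: "\<lbrakk>y \<in> ball x i; adj y z\<rbrakk> \<Longrightarrow> z \<in> ball x (Suc i)"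
  by auto

lemma in_ball_Suc: "z \<in> ball x (Suc i) \<Longrightarrow> z \<in> ball x i \<or> (\<exists>y\<in>ball x i. adj y z)"
  by auto

lemma finite_ball [simp]: "finite (ball x i)"
  by (induction i) auto

lemma ball_subset_V: "x \<in> V \<Longrightarrow> ball x i \<subseteq> V"
  using nbs_subset by (induction i) auto

lemma ball_closed_subset:
  assumes "x \<in> S" "\<And>y z. \<lbrakk>y \<in> S; adj y z\<rbrakk> \<Longrightarrow> z \<in> S"
  shows "ball x i \<subseteq> S"
  using assms by (induction i) auto

lemma card_ball_le:
  assumes degree: "\<And>x. x \<in> V \<Longrightarrow> card (nbs x) = k" and x: "x \<in> V"
  shows "card (ball x i) \<le> (k + 1) ^ i"
proof (induction i)
  case 0
  then show ?case by simp
next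
  case (Suc i)
  have "card (ball x (Suc i)) \<le> card (ball x i) + card (\<Union>y\<in>ball x i. nbs y)"
    by (simp add: card_Un_le)
  also have "card (\<Union>y\<in>ball x i. nbs y) \<le> (\<Sum>y\<in>ball x i. card (nbs y))"
    by (intro card_UN_le) simp
  also have "\<dots> = (\<Sum>y\<in>ball x i. k)"
    using ball_subset_V[OF x] degree by (intro sum.cong) auto
  finally have "card (ball x (Suc i)) \<le> card (ball x i) * (k + 1)" by simp
  also have "\<dots> \<le> (k + 1) ^ i * (k + 1)"
    using Suc.IH by (rule mult_le_mono1)
  finally show ?case by (simp add: mult.commute)
qed

lemma at_dist2I: "\<lbrakk>x \<noteq> y; \<not> adj x y; adj a x; adj a y\<rbrakk> \<Longrightarrow> at_dist2 x y"
  using adj_sym unfolding at_dist2_def by (metis IntI empty_iff in_nbs)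

text \<open>If no edge left \<open>ball x 2\<close>, that ball would contain \<open>ball x D\<close>
  and hence \<open>V\<close>. An edge leaving it ends a shortest path x, y, z, w of length
  3.\<close>

lemma ex_dist3:
  assumes diam: "V \<subseteq> ball x D" and far: "\<not> V \<subseteq> ball x 2" and x: "x \<in> V"
  obtains y z w where "adj x y" "adj y z" "adj z w" "x \<noteq> w" "\<not> adj x w" "nbs x \<inter> nbs w = {}"
    "at_dist2 y w"
proof -
  have "\<exists>z\<in>ball x 2. \<exists>w. adj z w \<and> w \<notin> ball x 2"
  proof (rule ccontr)
    assume "\<not> ?thesis"
    then have "\<And>y z. \<lbrakk>y \<in> ball x 2; adj y z\<rbrakk> \<Longrightarrow> z \<in> ball x 2" by blast
    moreover have "x \<in> ball x 2" by (simp add: numeral_2_eq_2)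
    ultimately have "ball x D \<subseteq> ball x 2" by (intro ball_closed_subset)
    with diam far show False by blast
  qed
  then obtain z w where zw: "z \<in> ball x 2" "adj z w" "w \<notin> ball x 2" by blast
  have ball2: "ball x 2 = insert x (nbs x) \<union> (\<Union>y\<in>insert x (nbs x). nbs y)"
    by (simp add: numeral_2_eq_2)
  have "z \<notin> insert x (nbs x)" using zw by (auto simp: ball2)
  then obtain y where y: "adj x y" "adj y z" using zw(1) by (auto simp: ball2)
  have w: "x \<noteq> w" "\<not> adj x w" "\<And>v. adj x v \<Longrightarrow> \<not> adj v w" using zw(3) by (auto simp: ball2)
  have "nbs x \<inter> nbs w = {}" using w(3) adj_commute by auto
  moreover have "at_dist2 y w"
  proof (rule at_dist2I)
    show "y \<noteq> w" using y(1) w(2) by blast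
    show "\<not> adj y w" using y(1) by (rule w(3))
    show "adj z y" using y(2) by (rule adj_sym)
  qed (rule zw(2))
  ultimately show ?thesis using that y zw(2) w by blast
qed

text \<open>
  Double counting of the edges between consecutive layers: a vertex \<open>w\<close> of the next layer
  has a vertex \<open>y\<close> at distance two in the ball such that all \<open>m\<close> common neighbours of \<open>y\<close> and \<open>w\<close>
  lie in the layer in between.
\<close>

lemma card_layer_le:
  assumes degree: "\<And>x. x \<in> V \<Longrightarrow> card (nbs x) = k"
    and common_dist2: "\<And>x y. at_dist2 x y \<Longrightarrow> card (nbs x \<inter> nbs y) = m"
    and x: "x \<in> V"
  defines "L \<equiv> \<lambda>i. ball x (Suc i) - ball x i"
  shows "card (L (Suc i)) * m \<le> card (L i) * k"
proof -
  have finL: "finite (L j)" for j by (simp add: L_def)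
  have "card (L (Suc i)) * m = (\<Sum>w\<in>L (Suc i). m)" by simp
  also have "\<dots> \<le> (\<Sum>w\<in>L (Suc i). \<Sum>v\<in>{v \<in> L i. adj v w}. 1)"
  proof (rule sum_mono)
    fix w assume w: "w \<in> L (Suc i)"
    then have "w \<in> ball x (Suc (Suc i))" "w \<notin> ball x (Suc i)" unfolding L_def by blast+
    then obtain z where z: "z \<in> ball x (Suc i)" "adj z w"
      using in_ball_Suc[of w x "Suc i"] by blast
    have w_far: "\<not> adj v w" if "v \<in> ball x i" for v
      using w ball_Suc_adj[OF that] by (auto simp: L_def)
    then have "z \<notin> ball x i" using z by blast
    then obtain y where y: "y \<in> ball x i" "adj y z" using z(1) by auto
    have "y \<in> ball x (Suc i)" using y(1) by simp
    then have "y \<noteq> w" using w unfolding L_def by blast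
    then have "at_dist2 y w"
      using w_far[OF y(1)] adj_sym[OF y(2)] z(2) by (rule at_dist2I)
    then have "m = card (nbs y \<inter> nbs w)" by (simp add: common_dist2)
    also have "\<dots> \<le> card {v \<in> L i. adj v w}"
    proof (rule card_mono)
      show "finite {v \<in> L i. adj v w}" using finL by simp
      show "nbs y \<inter> nbs w \<subseteq> {v \<in> L i. adj v w}"
        using y(1) w_far adj_commute by (auto simp: L_def)
    qed
    finally show "m \<le> (\<Sum>v\<in>{v \<in> L i. adj v w}. 1)" by simp
  qed
  also have "\<dots> = (\<Sum>v\<in>L i. \<Sum>w\<in>{w \<in> L (Suc i). adj v w}. 1)"
    by (intro sum.swap_restrict finL)
  also have "\<dots> \<le> (\<Sum>v\<in>L i. k)"
  proof (rule sum_mono)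
    fix v assume "v \<in> L i"
    then have v: "v \<in> V" using ball_subset_V[OF x, of "Suc i"] unfolding L_def by blast
    have "card {w \<in> L (Suc i). adj v w} \<le> card (nbs v)"
      by (rule card_mono) auto
    then show "(\<Sum>w\<in>{w \<in> L (Suc i). adj v w}. 1) \<le> k" using degree[OF v] by simp
  qed
  finally show ?thesis by simp
qed

text \<open>Consecutive layers grow by a factor of at most k / m \<le> M. Only the first layer
  contributes a factor \<open>k\<close>, so the bound is linear in \<open>k\<close>.\<close>

lemma card_V_le:
  assumes degree: "\<And>x. x \<in> V \<Longrightarrow> card (nbs x) = k"
    and common_dist2: "\<And>x y. at_dist2 x y \<Longrightarrow> card (nbs x \<inter> nbs y) = m"
    and x: "x \<in> V" and diam: "V \<subseteq> ball x D" and k: "k \<le> M * m" "k \<ge> 1"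
  shows "card V \<le> (D + 1) * M ^ D * k"
proof -
  \<comment> \<open>\<open>L i\<close> is the layer at distance i + 1; the induction starts with the
    neighbours of \<open>x\<close>.\<close>
  define L where "L i = ball x (Suc i) - ball x i" for i
  have M: "M \<ge> 1" "m \<ge> 1" using k by (auto simp: Suc_le_eq intro: ccontr)
  have layer: "card (L i) \<le> k * M ^ i" for i
  proof (induction i)
    case 0
    have "card (L 0) \<le> card (nbs x)" by (rule card_mono) (auto simp: L_def)
    then show ?case using degree[OF x] by simp
  next
    case (Suc i)
    have "card (L (Suc i)) * m \<le> card (L i) * k"
      unfolding L_def by (rule card_layer_le[OF degree common_dist2 x])
    also have "\<dots> \<le> card (L i) * (M * m)" using k(1) by simp
    finally have "card (L (Suc i)) \<le> card (L i) * M" using M(2) by (simp flip: mult.assoc)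
    also have "\<dots> \<le> k * M ^ i * M" using Suc.IH by simp
    finally show ?case by (simp add: mult_ac)
  qed
  have "card (ball x i) \<le> 1 + i * (M ^ D * k)" if "i \<le> D" for i
    using that
  proof (induction i)
    case 0
    then show ?case by simp
  next
    case (Suc i)
    have "ball x (Suc i) = ball x i \<union> L i" by (auto simp: L_def)
    then have "card (ball x (Suc i)) \<le> card (ball x i) + card (L i)" by (metis card_Un_le)
    moreover have "k * M ^ i \<le> M ^ D * k"
      unfolding mult.commute[of k] using Suc.prems M(1)
      by (intro mult_le_mono1 power_increasing) auto
    moreover have "card (ball x i) \<le> 1 + i * (M ^ D * k)" using Suc by simp
    moreover have "1 + Suc i * (M ^ D * k) = 1 + i * (M ^ D * k) + M ^ D * k" by simp
    ultimately show ?case using layer[of i] by linarith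
  qed
  from this[OF order_refl] have "card (ball x D) \<le> 1 + D * (M ^ D * k)" .
  moreover have "card V \<le> card (ball x D)" using diam by (simp add: card_mono)
  moreover have "1 \<le> M ^ D * k" using M(1) k(2) by simp
  moreover have "(D + 1) * M ^ D * k = D * (M ^ D * k) + M ^ D * k"
    by (simp add: algebra_simps)
  ultimately show ?thesis by linarith
qed

end

definition claw_number :: "real \<Rightarrow> nat" where
  "claw_number \<omega> = nat \<lfloor>\<omega>\<^sup>2\<rfloor>"

text \<open>The factor in k \<le> \<open>degree_ratio\<close> * m: it is q times the threshold 2q(q
  + 1), from k \<le> q(l + 1).\<close>

definition degree_ratio :: "real \<Rightarrow> nat" where
  "degree_ratio \<omega> = 2 * claw_number \<omega> * claw_number \<omega> * (claw_number \<omega> + 1)"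

text \<open>The first entry serves the case of equal idempotent entries at distances 0 and 2. The
  second is Godsil's (mult + 1)^2 with the multiplicity bounded by the trace.\<close>

definition degree_bound :: "real \<Rightarrow> nat \<Rightarrow> nat" where
  "degree_bound \<omega> D = max (2 * claw_number \<omega>)
     ((nat \<lfloor>4 * \<omega>\<^sup>2 * real ((D + 1) * degree_ratio \<omega> ^ D)\<rfloor> + 1)\<^sup>2)"

locale two_walk_regular = graph_spectrum +
  fixes k l m D :: nat and \<omega> :: real
  assumes degree: "x \<in> V \<Longrightarrow> card (nbs x) = k"
    and common_adj: "adj x y \<Longrightarrow> card (nbs x \<inter> nbs y) = l"
    and common_dist2: "at_dist2 x y \<Longrightarrow> card (nbs x \<inter> nbs y) = m"
    and walks_diag: "\<lbrakk>x \<in> V; x' \<in> V\<rbrakk> \<Longrightarrow> walks i x x = walks i x' x'"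
    and walks_adj: "\<lbrakk>adj x y; adj x' y'\<rbrakk> \<Longrightarrow> walks i x y = walks i x' y'"
    and walks_dist2: "\<lbrakk>at_dist2 x y; at_dist2 x' y'\<rbrakk> \<Longrightarrow> walks i x y = walks i x' y'"
    and diam: "x \<in> V \<Longrightarrow> V \<subseteq> ball x D"
    and dist3: "\<exists>x\<in>V. \<not> V \<subseteq> ball x 2"
    and \<omega>_pos: "\<omega> > 0"
    and low: "u \<in> U \<Longrightarrow> - \<omega> \<le> \<theta> u"
begin

abbreviation q :: nat where
  "q \<equiv> claw_number \<omega>"

lemma dist3E:
  obtains x y z w where "adj x y" "adj y z" "adj z w" "x \<noteq> w" "\<not> adj x w" "nbs x \<inter> nbs w = {}"
    "at_dist2 y w"
  using dist3 ex_dist3[OF diam] by metis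

lemma V_nonempty: "V \<noteq> {}"
  using dist3 by blast

lemma k_pos: "k \<ge> 1"
proof -
  obtain x y where "adj x y" using dist3E by metis
  then have "y \<in> nbs x" "card (nbs x) = k" using adj_in_V degree by auto
  then show ?thesis by (metis card_0_eq empty_iff finite_nbs less_one not_le)
qed

lemma m_pos: "m \<ge> 1"
proof -
  obtain y w where yw: "at_dist2 y w" using dist3E by metis
  then have "nbs y \<inter> nbs w \<noteq> {}" by (simp add: at_dist2_def)
  then show ?thesis using common_dist2[OF yw] by (metis card_0_eq finite_Int finite_nbs less_one not_le)
qed

lemma claw:
  assumes "x \<in> V" "S \<subseteq> nbs x" "independent S"
  shows "card S \<le> q"
proof -
  have "real (card S) \<le> \<omega>\<^sup>2"
    using low \<omega>_pos assms(2,3,1) by (rule card_independent_le)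
  then show ?thesis unfolding claw_number_def by (simp add: le_nat_floor)
qed

lemma q_pos: "q \<ge> 1"
proof -
  obtain x y where xy: "adj x y" using dist3E by metis
  then have "card {y} \<le> q" using adj_in_V adj_irrefl by (intro claw[of x]) (auto simp: independent_def)
  then show ?thesis by simp
qed

sublocale claw_bounded_graph V adj k l m q
proof
  show "card (nbs x \<inter> nbs y) \<le> m" if "x \<in> V" "y \<in> V" "x \<noteq> y" "\<not> adj x y" for x y
    using that common_dist2[of x y] by (cases "nbs x \<inter> nbs y = {}") (auto simp: at_dist2_def)
qed (use degree common_adj claw in auto)

text \<open>On a shortest path x, y, z, w, the neighbours that \<open>y\<close> shares with
  \<open>x\<close> and those it shares with \<open>w\<close> are disjoint, since \<open>x\<close>
  and \<open>w\<close> have no common neighbour.\<close>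

lemma l_plus_m_le: "l + m \<le> k"
proof -
  obtain x y z w where xyw: "adj x y" "nbs x \<inter> nbs w = {}" "at_dist2 y w"
    using dist3E by metis
  have "l + m = card (nbs y \<inter> nbs x) + card (nbs y \<inter> nbs w)"
    using common_adj common_dist2[OF xyw(3)] xyw(1) adj_commute by simp
  also have "\<dots> = card ((nbs y \<inter> nbs x) \<union> (nbs y \<inter> nbs w))"
    using xyw(2) by (intro card_Un_disjoint[symmetric]) auto
  also have "\<dots> \<le> card (nbs y)" by (rule card_mono) auto
  also have "\<dots> = k" using xyw(1) adj_in_V adj_sym degree by blast
  finally show ?thesis .
qed

text \<open>One polynomial in the adjacency matrix serves all pairs at once; this carries
  walk-regularity over to the idempotents.\<close>

lemma idem_eqI:
  assumes "x \<in> V" "y \<in> V" "x' \<in> V" "y' \<in> V" "\<And>i. walks i x y = walks i x' y'"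
  shows "idem t x y = idem t x' y'"
proof -
  obtain p :: "real poly" where
    "\<And>x y. \<lbrakk>x \<in> V; y \<in> V\<rbrakk> \<Longrightarrow> idem t x y = (\<Sum>i\<le>degree p. coeff p i * real (walks i x y))"
    by (rule idem_polynomial) (rule that)
  with assms show ?thesis by simp
qed

lemma at_dist2_in_V: "at_dist2 x y \<Longrightarrow> x \<in> V \<and> y \<in> V"
  using adj_in_V by (auto simp: at_dist2_def)

lemma idem_diag: "\<lbrakk>x \<in> V; x' \<in> V\<rbrakk> \<Longrightarrow> idem t x x = idem t x' x'"
  by (intro idem_eqI walks_diag)

lemma idem_adj: "\<lbrakk>adj x y; adj x' y'\<rbrakk> \<Longrightarrow> idem t x y = idem t x' y'"
  by (intro idem_eqI walks_adj) (auto intro: adj_in_V adj_sym)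

lemma idem_dist2: "\<lbrakk>at_dist2 x y; at_dist2 x' y'\<rbrakk> \<Longrightarrow> idem t x y = idem t x' y'"
  by (intro idem_eqI walks_dist2) (auto dest: at_dist2_in_V)

text \<open>
  Godsil's multiplicity bound. With $\alpha, \beta, \gamma$ the entries of the idempotent at distances
  $0, 1, 2$, the matrix with entries $(E_{zy} - \beta)(E_{zy} - \gamma)$ on a neighbourhood is a nonzero
  multiple of the identity and has rank at most $(\mathrm{mult} + 1)^2$.
\<close>

lemma degree_le_multiplicity:
  assumes \<alpha>\<beta>: "\<And>x. x \<in> V \<Longrightarrow> idem t x x = \<alpha>" "\<And>x y. adj x y \<Longrightarrow> idem t x y = \<beta>" "\<alpha> \<noteq> \<beta>"
    and \<gamma>: "\<And>x y. at_dist2 x y \<Longrightarrow> idem t x y = \<gamma>" "\<alpha> \<noteq> \<gamma>"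
  shows "k \<le> (card (eigenspace t) + 1)\<^sup>2"
proof (rule ccontr)
  assume large: "\<not> ?thesis"
  obtain x where x: "x \<in> V" using V_nonempty by blast
  \<comment> \<open>With the constant 1 added, products of two elements of \<open>W\<close> include
    1, every u and every u w. Orthogonality to these makes \<open>c\<close> annihilate the powers 0,
    1 and 2 of the idempotent entries.\<close>
  define W where "W = insert (\<lambda>_. 1) (eigenspace t)"
  have W: "finite W" "card W \<le> card (eigenspace t) + 1"
    by (simp_all add: W_def card_insert_le_m1)
  have "card (W \<times> W) \<le> (card (eigenspace t) + 1)\<^sup>2"
    unfolding card_cartesian_product power2_eq_square using W(2) W(2) by (rule mult_le_mono)
  also have "\<dots> < card (nbs x)" using large degree[OF x] by simp
  finally have "card (W \<times> W) < card (nbs x)" .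
  from ex_nontrivial_solution[OF _ finite_nbs this, of "\<lambda>(g, h) z. g z * h z"] W(1)
  obtain c where c: "\<exists>y\<in>nbs x. c y \<noteq> 0"
    "\<And>g h. \<lbrakk>g \<in> W; h \<in> W\<rbrakk> \<Longrightarrow> (\<Sum>z\<in>nbs x. c z * (g z * h z)) = 0"
    by auto
  obtain y where y: "y \<in> nbs x" "c y \<noteq> 0" using c(1) by blast
  have W_mem: "(\<lambda>_. 1) \<in> W" "\<And>u. u \<in> eigenspace t \<Longrightarrow> u \<in> W" by (auto simp: W_def)
  have c0: "(\<Sum>z\<in>nbs x. c z) = 0" using c(2)[OF W_mem(1) W_mem(1)] by simp
  have c1: "(\<Sum>z\<in>nbs x. c z * idem t z y) = 0"
  proof -
    have "(\<Sum>z\<in>nbs x. c z * idem t z y)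
        = (\<Sum>u\<in>eigenspace t. u y * (\<Sum>z\<in>nbs x. c z * (u z * 1)))"
      unfolding idem_def sum_distrib_left by (subst sum.swap) (simp add: mult_ac)
    also have "\<dots> = (\<Sum>u\<in>eigenspace t. u y * 0)"
      by (intro sum.cong refl arg_cong2[of _ _ _ _ times]) (rule c(2)[OF W_mem(2) W_mem(1)])
    finally show ?thesis by simp
  qed
  have c2: "(\<Sum>z\<in>nbs x. c z * (idem t z y)\<^sup>2) = 0"
  proof -
    have "(\<Sum>z\<in>nbs x. c z * (idem t z y)\<^sup>2)
        = (\<Sum>z\<in>nbs x. \<Sum>u\<in>eigenspace t. \<Sum>w\<in>eigenspace t. u y * w y * (c z * (u z * w z)))"
    proof (intro sum.cong refl)
      fix z
      have "(idem t z y)\<^sup>2 = (\<Sum>u\<in>eigenspace t. \<Sum>w\<in>eigenspace t. (u z * u y) * (w z * w y))"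
        unfolding idem_def power2_eq_square by (rule sum_product)
      then show "c z * (idem t z y)\<^sup>2
          = (\<Sum>u\<in>eigenspace t. \<Sum>w\<in>eigenspace t. u y * w y * (c z * (u z * w z)))"
        by (simp add: sum_distrib_left mult_ac)
    qed
    also have "\<dots> = (\<Sum>u\<in>eigenspace t. \<Sum>z\<in>nbs x. \<Sum>w\<in>eigenspace t. u y * w y * (c z * (u z * w z)))"
      by (rule sum.swap)
    also have "\<dots> = (\<Sum>u\<in>eigenspace t. \<Sum>w\<in>eigenspace t. \<Sum>z\<in>nbs x. u y * w y * (c z * (u z * w z)))"
      by (intro sum.cong refl sum.swap)
    also have "\<dots> = (\<Sum>u\<in>eigenspace t. \<Sum>w\<in>eigenspace t. u y * w y * 0)"
      by (intro sum.cong refl) (simp add: c(2) W_mem flip: sum_distrib_left)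
    finally show ?thesis by simp
  qed
  have entry: "(idem t z y - \<beta>) * (idem t z y - \<gamma>) = (if z = y then (\<alpha> - \<beta>) * (\<alpha> - \<gamma>) else 0)"
    if z: "z \<in> nbs x" for z
  proof -
    consider "z = y" | "adj z y" | "at_dist2 z y"
      using z y(1) at_dist2I[of z y x] by auto
    then show ?thesis
    proof cases
      case 1
      moreover have "y \<in> V" using y(1) nbs_subset by blast
      ultimately show ?thesis using \<alpha>\<beta>(1) by simp
    next
      case 2
      then show ?thesis using \<alpha>\<beta>(2) adj_irrefl by auto
    next
      case 3
      then show ?thesis using \<gamma>(1) by (auto simp: at_dist2_def)
    qed
  qed
  have "c y * ((\<alpha> - \<beta>) * (\<alpha> - \<gamma>)) = (\<Sum>z\<in>nbs x. if z = y then c z * ((\<alpha> - \<beta>) * (\<alpha> - \<gamma>)) else 0)"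
    using y(1) by simp
  also have "\<dots> = (\<Sum>z\<in>nbs x. c z * ((idem t z y - \<beta>) * (idem t z y - \<gamma>)))"
    by (intro sum.cong refl) (simp add: entry)
  also have "\<dots> = (\<Sum>z\<in>nbs x. c z * (idem t z y)\<^sup>2) - (\<beta> + \<gamma>) * (\<Sum>z\<in>nbs x. c z * idem t z y)
      + \<beta> * \<gamma> * (\<Sum>z\<in>nbs x. c z)"
    unfolding sum_distrib_left sum.distrib[symmetric] sum_subtractf[symmetric]
    by (intro sum.cong refl) (simp add: power2_eq_square algebra_simps)
  also have "\<dots> = 0" by (simp add: c0 c1 c2)
  finally show False using y(2) \<alpha>\<beta>(3) \<gamma>(2) by simp
qed

text \<open>
  If $\alpha = \gamma$, the local graphs are complete multipartite with parts of size at most \<open>q\<close>.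
\<close>

lemma degree_le_degenerate:
  assumes \<alpha>\<beta>: "\<And>x. x \<in> V \<Longrightarrow> idem t x x = \<alpha>" "\<And>x y. adj x y \<Longrightarrow> idem t x y = \<beta>" "\<alpha> \<noteq> \<beta>"
    and \<gamma>: "\<And>x y. at_dist2 x y \<Longrightarrow> idem t x y = \<alpha>"
  shows "k \<le> 2 * q"
proof -
  have agree: "u y = u z" if yz: "at_dist2 y z" and u: "u \<in> eigenspace t" for y z u
  proof -
    have "y \<in> V" "z \<in> V" using yz adj_in_V by (auto simp: at_dist2_def)
    then have "(\<Sum>u\<in>eigenspace t. (u y - u z)\<^sup>2) = 0"
      using \<gamma>[OF yz] \<alpha>\<beta>(1) by (simp add: sum_diff_squares_idem)
    then show ?thesis using u by (simp add: sum_nonneg_eq_0_iff)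
  qed
  have differ: "\<exists>u\<in>eigenspace t. u y \<noteq> u z" if yz: "adj y z" for y z
  proof (rule ccontr)
    assume "\<not> ?thesis"
    then have "(\<Sum>u\<in>eigenspace t. (u y - u z)\<^sup>2) = 0" by simp
    moreover have "y \<in> V" "z \<in> V" using yz adj_in_V adj_sym by blast+
    ultimately show False
      using \<alpha>\<beta>(1,2,3) yz by (simp add: sum_diff_squares_idem)
  qed
  obtain x a where xa: "adj a x" "\<exists>b. at_dist2 x b \<and> adj a b"
  proof -
    obtain y w where "at_dist2 y w" using dist3E by metis
    moreover from this obtain z where "adj z y" "adj z w"
      using adj_commute by (auto simp: at_dist2_def)
    ultimately show ?thesis using that by blast
  qed
  then obtain b where b: "at_dist2 x b" "adj a b" by blast
  have a: "a \<in> V" using xa(1) by (rule adj_in_V)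
  \<comment> \<open>A common neighbour y of \<open>a\<close> and \<open>x\<close> not adjacent to
    \<open>b\<close> would be at distance two from \<open>b\<close>, so all eigenfunctions would
    agree at y, b and x although y is adjacent to x.\<close>
  have "insert a (nbs a \<inter> nbs x) \<subseteq> nbs x \<inter> nbs b"
  proof -
    have "adj y b" if y: "adj a y" "adj x y" for y
    proof (rule ccontr)
      assume "\<not> adj y b"
      moreover have "y \<noteq> b" using y b by (auto simp: at_dist2_def)
      ultimately have "at_dist2 y b" using y(1) b(2) by (intro at_dist2I)
      then have "\<And>u. u \<in> eigenspace t \<Longrightarrow> u x = u y" using agree b(1) by metis
      then show False using differ[OF y(2)] by blast
    qed
    then show ?thesis using xa(1) b(2) adj_commute by auto
  qed
  then have "card (insert a (nbs a \<inter> nbs x)) \<le> card (nbs x \<inter> nbs b)"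
    by (rule card_mono[rotated]) simp
  then have lm: "l + 1 \<le> m"
    using common_adj[OF xa(1)] common_dist2[OF b(1)] adj_irrefl by simp
  \<comment> \<open>This is the part containing \<open>x\<close>: all eigenfunctions take their
    value at \<open>x\<close> throughout it, whereas adjacent vertices are separated by one.\<close>
  have "independent (nbs a - nbs x)"
    unfolding independent_def
  proof (intro ballI notI)
    fix y z assume yz: "y \<in> nbs a - nbs x" "z \<in> nbs a - nbs x" "adj y z"
    have same: "u v = u x" if "v \<in> nbs a - nbs x" "u \<in> eigenspace t" for u v
    proof (cases "v = x")
      case False
      then have "at_dist2 v x" using that(1) xa(1) adj_sym by (intro at_dist2I[of _ _ a]) auto
      then show ?thesis using that(2) by (rule agree)
    qed simp
    from differ[OF yz(3)] same yz show False by metis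
  qed
  then have "card (nbs a - nbs x) \<le> q" by (intro claw[OF a]) auto
  moreover have "card (nbs a - nbs x) = card (nbs a) - card (nbs a \<inter> nbs x)"
    by (rule card_Diff_subset_Int) simp
  ultimately have "k \<le> q + l" using degree[OF a] common_adj[OF xa(1)] by simp
  \<comment> \<open>From 2l + 1 \<le> l + m \<le> k \<le> q + l follows l < q.\<close>
  then show ?thesis using lm l_plus_m_le by linarith
qed

text \<open>Equal entries at distances 0 and 1 would make \<open>u\<close> constant along edges,
  hence on \<open>V\<close>, against the hypothesis. Equality at distances 0 and 2 decides which of
  the two bounds applies.\<close>

lemma degree_le_eigenspace:
  assumes u: "u \<in> eigenspace t" and nonconst: "x \<in> V" "w \<in> V" "u x \<noteq> u w"
  shows "k \<le> max (2 * q) ((card (eigenspace t) + 1)\<^sup>2)"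
proof -
  obtain a b where ab: "adj a b" using dist3E by metis
  obtain c d where cd: "at_dist2 c d" using dist3E by metis
  note \<alpha> = idem_diag[OF _ adj_in_V[OF ab], of _ t]
  note \<beta> = idem_adj[OF _ ab, of _ _ t]
  note \<gamma> = idem_dist2[OF _ cd, of _ _ t]
  have ne: "idem t a a \<noteq> idem t a b"
  proof
    assume eq: "idem t a a = idem t a b"
    have const: "u z = u y" if yz: "adj y z" for y z
    proof -
      have "y \<in> V" "z \<in> V" using yz adj_in_V adj_sym by blast+
      then have "(\<Sum>u\<in>eigenspace t. (u y - u z)\<^sup>2) = 0"
        using \<alpha> \<beta>[OF yz] eq by (simp add: sum_diff_squares_idem)
      then have "\<forall>u\<in>eigenspace t. u y = u z" by (simp add: sum_nonneg_eq_0_iff)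
      then show ?thesis using u by metis
    qed
    have "ball x D \<subseteq> {y. u y = u x}"
      by (rule ball_closed_subset) (auto dest: const)
    then have "V \<subseteq> {y. u y = u x}" using diam[OF nonconst(1)] by (rule subset_trans[rotated])
    then show False using nonconst(2,3) by auto
  qed
  show ?thesis
  proof (cases "idem t a a = idem t c d")
    case True
    have "k \<le> 2 * q"
      using \<alpha> \<beta> ne \<gamma>[folded True] by (rule degree_le_degenerate)
    then show ?thesis by simp
  next
    case False
    have "k \<le> (card (eigenspace t) + 1)\<^sup>2"
      using \<alpha> \<beta> ne \<gamma> False by (rule degree_le_multiplicity)
    then show ?thesis by (rule max.coboundedI2)
  qed
qed

lemma degree_bounded:
  assumes small: "l < 2 * q * (q + 1) * m"
  shows "k \<le> degree_bound \<omega> D"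
proof -
  define C where "C = real ((D + 1) * degree_ratio \<omega> ^ D)"
  have "k \<le> q * (l + 1)" using V_nonempty degree_le by blast
  also have "\<dots> \<le> q * (2 * q * (q + 1) * m)" using small by (intro mult_le_mono2) simp
  also have "\<dots> = degree_ratio \<omega> * m" by (simp add: degree_ratio_def algebra_simps)
  finally have ratio: "k \<le> degree_ratio \<omega> * m" .
  obtain x0 where x0: "x0 \<in> V" using V_nonempty by blast
  have "card V \<le> (D + 1) * degree_ratio \<omega> ^ D * k"
    using degree common_dist2 x0 diam[OF x0] ratio k_pos by (rule card_V_le)
  then have n: "real (card V) \<le> C * real k" unfolding C_def by (metis of_nat_le_iff of_nat_mult)
  obtain x w where xw: "x \<in> V" "w \<in> V" "x \<noteq> w" "\<not> adj x w" "nbs x \<inter> nbs w = {}"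
    using dist3E adj_in_V adj_sym by metis
  \<comment> \<open>Half of the limit k / \<omega> at which the quadratic form vanishes. Any fixed
    proportion below it would do, since only s^2 of order k^2 matters.\<close>
  define s where "s = real k / (2 * \<omega>)"
  have s: "\<omega> * s < real k" "s > 0" using \<omega>_pos k_pos by (auto simp: s_def)
  obtain u where u: "u \<in> U" "u x \<noteq> u w" "s < \<theta> u"
    using low xw degree[OF xw(1)] degree[OF xw(2)] s(1) by (rule ex_large_eigenvalue)
  define t where "t = \<theta> u"
  define M where "M = card (eigenspace t)"
  have "real M * s\<^sup>2 \<le> real M * t\<^sup>2"
    using u(3) s(2) by (intro mult_left_mono power_mono) (auto simp: t_def)
  also have "\<dots> \<le> real (card V) * real k"
    unfolding M_def using degree by (rule multiplicity_bound)
  also have "\<dots> \<le> C * real k * real k" using n by (intro mult_right_mono) auto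
  also have "\<dots> = 4 * \<omega>\<^sup>2 * C * s\<^sup>2"
    using \<omega>_pos by (simp add: s_def power2_eq_square field_simps)
  finally have "real M \<le> 4 * \<omega>\<^sup>2 * C" using s(2) by simp
  then have "M \<le> nat \<lfloor>4 * \<omega>\<^sup>2 * C\<rfloor>" by (rule le_nat_floor)
  then have "(M + 1)\<^sup>2 \<le> (nat \<lfloor>4 * \<omega>\<^sup>2 * C\<rfloor> + 1)\<^sup>2" by (intro power_mono) auto
  moreover have "k \<le> max (2 * q) ((M + 1)\<^sup>2)"
    unfolding M_def using u xw by (intro degree_le_eigenspace[of u]) (auto simp: eigenspace_def t_def)
  ultimately show ?thesis unfolding degree_bound_def C_def by linarith
qed

lemma card_V_bounded:
  assumes small: "l < 2 * q * (q + 1) * m"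
  shows "card V \<le> (degree_bound \<omega> D + 1) ^ D"
proof -
  obtain x where x: "x \<in> V" using V_nonempty by blast
  have "card V \<le> card (ball x D)" using diam[OF x] by (simp add: card_mono)
  also have "\<dots> \<le> (k + 1) ^ D" using degree x by (rule card_ball_le)
  also have "\<dots> \<le> (degree_bound \<omega> D + 1) ^ D"
    using degree_bounded[OF small] by (intro power_mono) auto
  finally show ?thesis .
qed

section \<open>Lines are Delsarte cliques\<close>

context
  assumes large: "2 * q * (q + 1) * m \<le> l"
begin

interpretation L: claw_bounded_large V adj k l m q
  by unfold_locales (use m_pos q_pos large in auto)

text \<open>
  There are fewer lines than vertices, so some function \<open>f\<close> sums to zero on every line. The
  eigenfunctions for $-s$ all have this property, which makes the idempotent annihilate the
  indicator function of each line.
\<close>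

lemma ex_delsarte_lines:
  obtains \<C> :: "'a set set" and s :: nat where
    "s \<ge> 1"
    "\<exists>f. is_eigenfunction (- real s) f"
    "\<And>c f. is_eigenfunction c f \<Longrightarrow> - real s \<le> c"
    "\<And>C. C \<in> \<C> \<Longrightarrow> is_clique C \<and> real (card C) = 1 + real k / real s"
    "\<And>x y. adj x y \<Longrightarrow> \<exists>!C. C \<in> \<C> \<and> x \<in> C \<and> y \<in> C"
proof -
  define s where "s = L.num_lines_at"
  define \<C> where "\<C> = {C. L.line C}"
  obtain x0 where x0: "x0 \<in> V" using V_nonempty by blast
  have "k \<le> s * (l + 1)"
    using L.degree_le_lines[OF x0] L.card_lines_at[OF x0] by (simp add: s_def)
  then have s: "s \<ge> 1" using k_pos by (cases s) auto
  obtain f :: "'a \<Rightarrow> real" where f: "\<exists>x\<in>V. f x \<noteq> 0" "\<And>C. L.line C \<Longrightarrow> (\<Sum>x\<in>C. f x) = 0"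
    using L.ex_vanishing_on_lines[OF V_nonempty] by blast
  have f_eig: "is_eigenfunction (- real s) f"
    unfolding is_eigenfunction_def using f by (auto simp: L.sum_nbs_lines_const s_def)
  have squares: "(c + real s) * (\<Sum>x\<in>V. (g x)\<^sup>2) = (\<Sum>C | L.line C. (\<Sum>x\<in>C. g x)\<^sup>2)"
    if "is_eigenfunction c g" for c g
  proof -
    have "(\<Sum>x\<in>V. g x * (\<Sum>y\<in>nbs x. g y)) = (\<Sum>x\<in>V. c * (g x)\<^sup>2)"
      using that by (intro sum.cong refl) (simp add: is_eigenfunction_def power2_eq_square)
    then show ?thesis
      using L.sum_squares_lines[of g] by (simp add: s_def distrib_right flip: sum_distrib_left)
  qed
  have low: "- real s \<le> c" if g: "is_eigenfunction c g" for c g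
  proof -
    have "(\<Sum>x\<in>V. (g x)\<^sup>2) > 0"
      using g finite_V by (auto simp: is_eigenfunction_def intro: sum_pos2)
    moreover have "0 \<le> (c + real s) * (\<Sum>x\<in>V. (g x)\<^sup>2)"
      unfolding squares[OF g] by (intro sum_nonneg) auto
    ultimately have "0 \<le> c + real s" by (simp add: zero_le_mult_iff)
    then show ?thesis by simp
  qed
  define t where "t = - real s"
  have vanish: "(\<Sum>x\<in>C. u x) = 0" if u: "u \<in> eigenspace t" and C: "L.line C" for u C
  proof -
    have "is_eigenfunction t u"
      using u eigenfunction_in_U by (auto simp: eigenspace_def)
    from squares[OF this] have "(\<Sum>C | L.line C. (\<Sum>x\<in>C. u x)\<^sup>2) = 0"
      by (simp add: t_def)
    then show ?thesis
      using C L.finite_lines by (simp add: sum_nonneg_eq_0_iff)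
  qed
  \<comment> \<open>The trace of the idempotent is the multiplicity, positive because of
    \<open>f\<close>; the diagonal entry can be cancelled below.\<close>
  have \<alpha>_pos: "idem t x0 x0 > 0"
  proof -
    obtain u where "u \<in> eigenspace t"
      using eigenvalue_in_U[OF f_eig] by (auto simp: eigenspace_def t_def)
    then have "card (eigenspace t) > 0" by (auto simp: card_gt_0_iff)
    then have "0 < (\<Sum>x\<in>V. idem t x x)" by (simp add: sum_idem_diag)
    also have "\<dots> = (\<Sum>x\<in>V. idem t x0 x0)"
      using idem_diag[OF _ x0] by (intro sum.cong) auto
    finally show ?thesis by (simp add: zero_less_mult_iff)
  qed
  obtain a b where ab: "adj a b" using dist3E by metis
  have \<beta>: "real k * idem t a b = - real s * idem t x0 x0"
  proof -
    have a: "a \<in> V" using ab by (rule adj_in_V)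
    have "(\<Sum>y\<in>nbs a. idem t a y) = (\<Sum>y\<in>nbs a. idem t a b)"
      using idem_adj[OF _ ab] by (intro sum.cong) auto
    then show ?thesis
      using sum_nbs_idem[OF a, of t] degree[OF a] idem_diag[OF a x0, of t] by (simp add: t_def)
  qed
  have card: "real (card C) = 1 + real k / real s" if C: "L.line C" for C
  proof -
    define c where "c = real (card C)"
    have fin: "finite C" using C by (rule L.finite_line)
    have c: "c > 0" using L.line_card_gt[OF C] by (simp add: c_def)
    have "(\<Sum>x\<in>C. \<Sum>y\<in>C. idem t x y) = (\<Sum>u\<in>eigenspace t. (\<Sum>x\<in>C. u x) * (\<Sum>y\<in>C. u y))"
    proof -
      have "(\<Sum>x\<in>C. \<Sum>y\<in>C. idem t x y) = (\<Sum>x\<in>C. \<Sum>u\<in>eigenspace t. u x * (\<Sum>y\<in>C. u y))"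
        unfolding idem_def by (subst sum.swap) (simp add: sum_distrib_left)
      also have "\<dots> = (\<Sum>u\<in>eigenspace t. (\<Sum>x\<in>C. u x) * (\<Sum>y\<in>C. u y))"
        by (subst sum.swap) (simp add: sum_distrib_right)
      finally show ?thesis .
    qed
    also have "\<dots> = 0" using vanish[OF _ C] by simp
    finally have "0 = (\<Sum>x\<in>C. \<Sum>y\<in>C. idem t x y)" ..
    \<comment> \<open>With diagonal entry \<alpha> and edge entry \<beta>, the vanishing quadratic
      form at the indicator of \<open>C\<close> is |C| (\<alpha> + (|C| - 1)\<beta>). Combined with
      k\<beta> = -s\<alpha> it determines |C|.\<close>
    also have "\<dots> = (\<Sum>x\<in>C. idem t x0 x0 + (c - 1) * idem t a b)"
    proof (rule sum.cong)
      fix x assume x: "x \<in> C"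
      have "(\<Sum>y\<in>C. idem t x y) = idem t x x + (\<Sum>y\<in>C - {x}. idem t x y)"
        using fin x by (rule sum.remove)
      also have "(\<Sum>y\<in>C - {x}. idem t x y) = (\<Sum>y\<in>C - {x}. idem t a b)"
        using L.line_adj[OF C x] idem_adj[OF _ ab] by (intro sum.cong) auto
      also have "\<dots> = (c - 1) * idem t a b"
        using x fin c by (simp add: c_def of_nat_diff)
      also have "idem t x x = idem t x0 x0"
        using x L.line_subset[OF C] x0 by (intro idem_diag) auto
      finally show "(\<Sum>y\<in>C. idem t x y) = idem t x0 x0 + (c - 1) * idem t a b" .
    qed simp
    also have "\<dots> = c * (idem t x0 x0 + (c - 1) * idem t a b)" by (simp add: c_def)
    finally have "idem t x0 x0 + (c - 1) * idem t a b = 0" using c by simp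
    then have "real k * idem t x0 x0 + (c - 1) * (real k * idem t a b) = 0"
      by (metis distrib_left mult.left_commute mult_zero_right)
    then have "(real k - (c - 1) * real s) * idem t x0 x0 = 0"
      unfolding \<beta> by (simp add: algebra_simps)
    then have "real k = (c - 1) * real s" using \<alpha>_pos by simp
    then show ?thesis using s by (simp add: c_def field_simps)
  qed
  have unique: "\<exists>!C. C \<in> \<C> \<and> x \<in> C \<and> y \<in> C" if xy: "adj x y" for x y
  proof -
    from L.adj_in_line[OF xy] obtain C where C: "L.line C" "x \<in> C" "y \<in> C" by blast
    have "x \<noteq> y" using xy adj_irrefl by blast
    show ?thesis
    proof (intro ex1I[of _ C])
      show "C \<in> \<C> \<and> x \<in> C \<and> y \<in> C" using C by (simp add: \<C>_def)
      show "C' = C" if "C' \<in> \<C> \<and> x \<in> C' \<and> y \<in> C'" for C'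
        using that C \<open>x \<noteq> y\<close> by (intro L.line_unique[of C' C x y]) (simp_all add: \<C>_def)
    qed
  qed
  have clique: "is_clique C \<and> real (card C) = 1 + real k / real s" if "C \<in> \<C>" for C
    using that card by (simp add: \<C>_def L.line_def)
  have "\<exists>f. is_eigenfunction (- real s) f" by (intro exI[of _ f] f_eig)
  with s show ?thesis using low clique unique by (rule that)
qed

end

end

section \<open>Graphs as digraphs\<close>

sublocale graph \<subseteq> FG: finite_graph "verts G" "\<lambda>x y. (x, y) \<in> arcs_ends G"
proof
  show "(y, x) \<in> arcs_ends G" if "(x, y) \<in> arcs_ends G" for x y
    using sym_arcs that by (rule arcs_ends_symmetric)
  show "(x, x) \<notin> arcs_ends G" for x
    using adj_not_same by blast
qed (auto dest: adj_in_verts)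

context graph
begin

lemma inj_on_head_out_arcs: "inj_on (head G) (out_arcs G v)"
  by (rule inj_onI) (auto intro: no_multi_arcs simp: arc_to_ends_def)

lemma nbs_eq_head_out_arcs: "FG.nbs v = head G ` out_arcs G v"
proof (rule Set.set_eqI)
  show "y \<in> FG.nbs v \<longleftrightarrow> y \<in> head G ` out_arcs G v" for y
    by (subst FG.in_nbs) (auto simp: arcs_ends_conv)
qed

lemma out_degree_eq_card_nbs: "out_degree G v = card (FG.nbs v)"
  by (simp add: out_degree_def nbs_eq_head_out_arcs card_image[OF inj_on_head_out_arcs])

lemma finite_awalks: "finite {p. awalk u p v \<and> length p = i}"
proof (rule finite_subset)
  show "{p. awalk u p v \<and> length p = i} \<subseteq> {p. set p \<subseteq> arcs G \<and> length p = i}"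
    by (auto simp: awalk_def)
  show "finite {p. set p \<subseteq> arcs G \<and> length p = i}"
    by (rule finite_lists_length_eq) simp
qed

text \<open>Walks are split by their first arc; without parallel arcs, \<open>head\<close> maps the
  arcs leaving \<open>u\<close> bijectively onto its neighbours.\<close>

lemma num_walks_eq_walks: "u \<in> verts G \<Longrightarrow> num_walks G i u v = FG.walks i u v"
proof (induction i arbitrary: u)
  case 0
  then have "{p. awalk u p v \<and> length p = 0} = (if u = v then {[]} else {})"
    by (auto simp: awalk_Nil_iff)
  then show ?case by (simp add: num_walks_def)
next
  case (Suc i)
  let ?P = "\<lambda>e. (#) e ` {p. awalk (head G e) p v \<and> length p = i}"
  have "{p. awalk u p v \<and> length p = Suc i} = (\<Union>e\<in>out_arcs G u. ?P e)"
    by (auto simp: length_Suc_conv awalk_Cons_iff)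
  then have "num_walks G (Suc i) u v = card (\<Union>e\<in>out_arcs G u. ?P e)"
    by (simp add: num_walks_def)
  also have "\<dots> = (\<Sum>e\<in>out_arcs G u. card (?P e))"
    using finite_awalks by (intro card_UN_disjoint) auto
  also have "\<dots> = (\<Sum>e\<in>out_arcs G u. num_walks G i (head G e) v)"
    by (simp add: card_image num_walks_def)
  also have "\<dots> = (\<Sum>e\<in>out_arcs G u. FG.walks i (head G e) v)"
    by (intro sum.cong) (auto simp: Suc.IH)
  also have "\<dots> = (\<Sum>z\<in>FG.nbs u. FG.walks i z v)"
    unfolding nbs_eq_head_out_arcs by (simp add: sum.reindex[OF inj_on_head_out_arcs])
  finally show ?case by simp
qed

lemma awalk_in_ball: "awalk u p v \<Longrightarrow> length p \<le> i \<Longrightarrow> v \<in> FG.ball u i"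
proof (induction p arbitrary: v i rule: rev_induct)
  case Nil
  have "u \<in> FG.ball u i" by (induction i) auto
  then show ?case using Nil by (simp add: awalk_Nil_iff)
next
  case (snoc e p)
  obtain j where j: "i = Suc j" "length p \<le> j" using snoc.prems(2) by (cases i) auto
  have e: "awalk u p (tail G e)" "e \<in> arcs G" "v = head G e"
    using snoc.prems(1) by (auto simp: awalk_simps)
  have "tail G e \<in> FG.ball u j" using snoc.IH e(1) j(2) by blast
  moreover have "(tail G e, v) \<in> arcs_ends G" using e by (auto simp: arcs_ends_conv)
  ultimately show ?case unfolding j(1) by (rule FG.ball_Suc_adj)
qed

lemma in_ball_awalk: "u \<in> verts G \<Longrightarrow> v \<in> FG.ball u i \<Longrightarrow> \<exists>p. awalk u p v \<and> length p \<le> i"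
proof (induction i arbitrary: v)
  case 0
  then show ?case by (auto simp: awalk_Nil_iff)
next
  case (Suc i)
  show ?case
  proof (cases "v \<in> FG.ball u i")
    case True
    then show ?thesis using Suc.IH[OF Suc.prems(1)] le_Suc_eq by blast
  next
    case False
    then obtain y where y: "y \<in> FG.ball u i" "(y, v) \<in> arcs_ends G"
      using FG.in_ball_Suc Suc.prems(2) by blast
    obtain p where p: "awalk u p y" "length p \<le> i" using Suc.IH[OF Suc.prems(1) y(1)] by blast
    obtain e where e: "e \<in> arcs G" "tail G e = y" "head G e = v" using y(2) by (rule reachableE)
    have "awalk u (p @ [e]) v"
      using p(1) arc_implies_awalk[OF e(1)] e(2,3) by (intro awalk_appendI) auto
    then show ?thesis using p(2) by (intro exI[of _ "p @ [e]"]) simp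
  qed
qed

lemma graph_dist_le_iff_ball:
  "u \<in> verts G \<Longrightarrow> graph_dist G u v \<le> ereal (real i) \<longleftrightarrow> v \<in> FG.ball u i"
  using graph_dist_le_iff[OF wf_digraph] awalk_in_ball in_ball_awalk by blast

lemma graph_dist_eqI:
  assumes u: "u \<in> verts G" and v: "v \<in> FG.ball u i" and min: "\<And>j. j < i \<Longrightarrow> v \<notin> FG.ball u j"
  shows "graph_dist G u v = ereal (real i)"
proof (rule antisym)
  show "graph_dist G u v \<le> ereal (real i)" using u v by (simp add: graph_dist_le_iff_ball)
  have cost: "awalk_cost (\<lambda>_. 1) p = real (length p)" for p
    by (induction p) auto
  show "ereal (real i) \<le> graph_dist G u v"
    unfolding graph_dist_def \<mu>_def cost
  proof (rule INF_greatest)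
    fix p assume "p \<in> {p. awalk u p v}"
    then have "v \<in> FG.ball u (length p)" using awalk_in_ball by simp
    then have "i \<le> length p" using min not_le by blast
    then show "ereal (real i) \<le> ereal (real (length p))" by simp
  qed
qed

lemma graph_dist_diag: "u \<in> verts G \<Longrightarrow> graph_dist G u u = ereal (real 0)"
  by (rule graph_dist_eqI) auto

lemma graph_dist_adj:
  assumes "(u, v) \<in> arcs_ends G"
  shows "graph_dist G u v = ereal (real 1)"
  using assms adj_in_verts FG.adj_irrefl by (intro graph_dist_eqI) auto

lemma graph_dist_dist2:
  assumes "FG.at_dist2 u v"
  shows "graph_dist G u v = ereal (real 2)"
proof (rule graph_dist_eqI)
  obtain z where z: "(u, z) \<in> arcs_ends G" "(z, v) \<in> arcs_ends G"
  proof -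
    obtain z where "z \<in> FG.nbs u \<inter> FG.nbs v" using assms unfolding FG.at_dist2_def by blast
    then have "(u, z) \<in> arcs_ends G" "(z, v) \<in> arcs_ends G"
      by (auto intro: FG.adj_sym)
    then show ?thesis by (rule that)
  qed
  then show "u \<in> verts G" by (simp add: adj_in_verts)
  show "v \<in> FG.ball u 2" using z by (auto simp: numeral_2_eq_2)
  show "v \<notin> FG.ball u j" if "j < 2" for j
    using that assms by (auto simp: FG.at_dist2_def numeral_2_eq_2 less_Suc_eq)
qed

lemma eigenvalue_iff_eigenfunction:
  "eigenvalue (adjacency_matrix G) c \<longleftrightarrow> (\<exists>f. FG.is_eigenfunction c f)"
  by (simp add: eigenvalue_adjacency_matrix_iff FG.is_eigenfunction_def FG.sum_nbs_conv)

lemma finite_spectrum: "finite (spectrum (adjacency_matrix G))"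
  by (rule card_finite_spectrum(1)[of _ "card (verts G)"]) (simp add: adjacency_matrix_def)

lemma smallest_eigenvalue_le: "FG.is_eigenfunction c f \<Longrightarrow> smallest_eigenvalue G \<le> c"
  unfolding smallest_eigenvalue_def using finite_spectrum
  by (intro Min_le) (auto simp: spectrum_def eigenvalue_iff_eigenfunction)

lemma smallest_eigenvalue_eqI:
  assumes "\<exists>f. FG.is_eigenfunction t f" "\<And>c f. FG.is_eigenfunction c f \<Longrightarrow> t \<le> c"
  shows "smallest_eigenvalue G = t"
  unfolding smallest_eigenvalue_def using finite_spectrum assms
  by (intro Min_eqI) (auto simp: spectrum_def eigenvalue_iff_eigenfunction)

text \<open>Valency, \<open>l\<close> and \<open>m\<close> are all numbers of walks of length 2, at
  distances 0, 1 and 2; regularity need not be assumed.\<close>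

lemma ex_two_walk_regular:
  fixes \<omega> :: real and D :: nat
  assumes reg: "walk_regular 2 G" and diam: "graph_diameter G = ereal (real D)" and D: "D \<ge> 3"
    and \<omega>: "\<omega> > 0" and low: "smallest_eigenvalue G \<ge> - \<omega>"
  obtains U \<theta> k l m
    where "two_walk_regular (verts G) (\<lambda>x y. (x, y) \<in> arcs_ends G) U \<theta> k l m D \<omega>"
proof -
  have walks: "FG.walks i x y = FG.walks i x' y'"
    if "x \<in> verts G" "y \<in> verts G" "x' \<in> verts G" "y' \<in> verts G" "j \<le> 2"
      "graph_dist G x y = ereal (real j)" "graph_dist G x' y' = ereal (real j)" for i j x y x' y'
  proof -
    have "\<And>l x y x' y'. \<lbrakk>x \<in> verts G; y \<in> verts G; x' \<in> verts G; y' \<in> verts G;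
        graph_dist G x y \<le> ereal (real 2); graph_dist G x' y' = graph_dist G x y\<rbrakk> \<Longrightarrow>
        num_walks G l x' y' = num_walks G l x y"
      using reg unfolding walk_regular_def by blast
    from this[OF that(1-4)] have "num_walks G i x' y' = num_walks G i x y"
      using that(5-7) by simp
    then show ?thesis using that by (simp add: num_walks_eq_walks)
  qed
  have diag: "FG.walks i x x = FG.walks i x' x'" if "x \<in> verts G" "x' \<in> verts G" for i x x'
    using that by (intro walks[of _ _ _ _ 0] graph_dist_diag) auto
  have adj: "FG.walks i x y = FG.walks i x' y'"
    if "(x, y) \<in> arcs_ends G" "(x', y') \<in> arcs_ends G" for i x y x' y'
    using that by (intro walks[of _ _ _ _ 1] graph_dist_adj) (auto dest: adj_in_verts)
  have dist2: "FG.walks i x y = FG.walks i x' y'"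
    if "FG.at_dist2 x y" "FG.at_dist2 x' y'" for i x y x' y'
    using that by (intro walks[of _ _ _ _ 2] graph_dist_dist2)
      (auto simp: FG.at_dist2_def dest: adj_in_verts)
  have const: "\<exists>c. \<forall>(x, y)\<in>A. FG.walks 2 x y = c"
    if "\<And>x y x' y'. \<lbrakk>(x, y) \<in> A; (x', y') \<in> A\<rbrakk> \<Longrightarrow> FG.walks 2 x y = FG.walks 2 x' y'" for A
  proof (cases "A = {}")
    case False
    then obtain x0 y0 where A: "(x0, y0) \<in> A" by auto
    have "\<forall>(x, y)\<in>A. FG.walks 2 x y = FG.walks 2 x0 y0"
      using that[OF _ A] by blast
    then show ?thesis ..
  qed simp
  have "\<exists>k. \<forall>(x, y)\<in>{(x, y). x \<in> verts G \<and> x = y}. FG.walks 2 x y = k"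
    by (rule const) (use diag in blast)
  then obtain k where k: "\<And>x. x \<in> verts G \<Longrightarrow> FG.walks 2 x x = k"
    by blast
  have "\<exists>l. \<forall>(x, y)\<in>arcs_ends G. FG.walks 2 x y = l"
    by (rule const) (use adj in blast)
  then obtain l where l: "\<And>x y. (x, y) \<in> arcs_ends G \<Longrightarrow> FG.walks 2 x y = l"
    by blast
  have "\<exists>m. \<forall>(x, y)\<in>{(x, y). FG.at_dist2 x y}. FG.walks 2 x y = m"
    by (rule const) (use dist2 in blast)
  then obtain m where m: "\<And>x y. FG.at_dist2 x y \<Longrightarrow> FG.walks 2 x y = m"
    by blast
  have dist_le: "graph_dist G x y \<le> ereal (real D)" if "x \<in> verts G" "y \<in> verts G" for x y
    unfolding diam[symmetric] graph_diameter_def using that by (intro SUP_upper2[of x] SUP_upper)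
  have far: "\<exists>x\<in>verts G. \<not> verts G \<subseteq> FG.ball x 2"
  proof (rule ccontr)
    assume "\<not> ?thesis"
    then have "graph_dist G x y \<le> ereal (real 2)" if "x \<in> verts G" "y \<in> verts G" for x y
      using that graph_dist_le_iff_ball by blast
    then have "graph_diameter G \<le> ereal (real 2)"
      unfolding graph_diameter_def by (intro SUP_least)
    then show False using diam D by simp
  qed
  obtain U \<theta> where spec: "graph_spectrum (verts G) (\<lambda>x y. (x, y) \<in> arcs_ends G) U \<theta>"
    by (rule FG.ex_graph_spectrum)
  interpret graph_spectrum "verts G" "\<lambda>x y. (x, y) \<in> arcs_ends G" U \<theta> by (rule spec)
  have "two_walk_regular (verts G) (\<lambda>x y. (x, y) \<in> arcs_ends G) U \<theta> k l m D \<omega>"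
  proof
    show "card (FG.nbs x) = k" if "x \<in> verts G" for x
      using k[OF that] by (simp add: FG.walks_2)
    show "card (FG.nbs x \<inter> FG.nbs y) = l" if "(x, y) \<in> arcs_ends G" for x y
      using l[OF that] by (simp add: FG.walks_2)
    show "card (FG.nbs x \<inter> FG.nbs y) = m" if "FG.at_dist2 x y" for x y
      using m[OF that] by (simp add: FG.walks_2)
    show "verts G \<subseteq> FG.ball x D" if "x \<in> verts G" for x
      using dist_le[OF that] graph_dist_le_iff_ball[OF that] by blast
    show "- \<omega> \<le> \<theta> u" if "u \<in> U" for u
      using smallest_eigenvalue_le[OF eigenfunction_in_U[OF that]] low by simp
  qed (fact diag adj dist2 far \<omega>)+
  then show ?thesis by (rule that)
qed

lemma geometric_or_card_verts_le:
  fixes \<omega> :: real and D :: nat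
  assumes "walk_regular 2 G" "graph_diameter G = ereal (real D)" "D \<ge> 3" "\<omega> > 0"
    "smallest_eigenvalue G \<ge> - \<omega>"
  shows "geometric G \<or> card (verts G) \<le> (degree_bound \<omega> D + 1) ^ D"
proof -
  obtain U \<theta> k l m
    where "two_walk_regular (verts G) (\<lambda>x y. (x, y) \<in> arcs_ends G) U \<theta> k l m D \<omega>"
    using assms by (rule ex_two_walk_regular)
  then interpret W: two_walk_regular "verts G" "\<lambda>x y. (x, y) \<in> arcs_ends G" U \<theta> k l m D \<omega> .
  show ?thesis
  proof (cases "2 * W.q * (W.q + 1) * m \<le> l")
    case True
    obtain \<C> and s :: nat where s: "s \<ge> 1"
      and ex: "\<exists>f. FG.is_eigenfunction (- real s) f"
      and low: "\<And>c f. FG.is_eigenfunction c f \<Longrightarrow> - real s \<le> c"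
      and card: "\<And>C. C \<in> \<C> \<Longrightarrow> FG.is_clique C \<and> real (card C) = 1 + real k / real s"
      and unique: "\<And>x y. (x, y) \<in> arcs_ends G \<Longrightarrow> \<exists>!C. C \<in> \<C> \<and> x \<in> C \<and> y \<in> C"
      by (rule W.ex_delsarte_lines[OF True]) (rule that)
    \<comment> \<open>This identifies the line size 1 + k/s with the Delsarte size 1 -
      k/\<theta>.\<close>
    have min: "smallest_eigenvalue G = - real s"
      using ex low by (rule smallest_eigenvalue_eqI)
    have "regular_graph G k"
      by (simp add: regular_graph_def out_degree_eq_card_nbs W.degree)
    then have delsarte: "Delsarte_clique G C" if "C \<in> \<C>" for C
      using card[OF that] min
      by (auto simp: Delsarte_clique_def clique_def FG.is_clique_def)
    have "geometric G"
      unfolding geometric_def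
    proof (intro exI[of _ \<C>] conjI ballI)
      show "Delsarte_clique G C" if "C \<in> \<C>" for C using that by (rule delsarte)
      show "case e of (u, v) \<Rightarrow> \<exists>!C. C \<in> \<C> \<and> u \<in> C \<and> v \<in> C" if "e \<in> arcs_ends G" for e
        using unique that by (cases e) simp
    qed
    then show ?thesis ..
  next
    case False
    then show ?thesis using W.card_V_bounded by simp
  qed
qed

end

section \<open>Finitely many isomorphism classes\<close>

text \<open>The code depends on the enumeration chosen by \<open>vertex_list\<close> and is no
  isomorphism invariant. It suffices that equal codes force isomorphism.\<close>

definition graph_code :: "('a, 'b) pre_digraph \<Rightarrow> nat \<times> (nat \<times> nat) set" where
  "graph_code G = (card (verts G),
     {(i, j). i < card (verts G) \<and> j < card (verts G) \<and>
        (vertex_list G ! i, vertex_list G ! j) \<in> arcs_ends G})"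

text \<open>An isomorphism must also map arcs. Each adjacent ordered pair carries exactly one arc,
  so \<open>f\<close> determines the arc map \<open>g\<close>.\<close>

lemma digraph_isoI:
  assumes G: "graph G" and H: "graph H"
    and f: "bij_betw f (verts G) (verts H)"
    and adj: "\<And>u v. \<lbrakk>u \<in> verts G; v \<in> verts G\<rbrakk> \<Longrightarrow>
      (u, v) \<in> arcs_ends G \<longleftrightarrow> (f u, f v) \<in> arcs_ends H"
  shows "digraph_iso G H"
proof -
  interpret G: graph G by (rule G)
  interpret H: graph H by (rule H)
  define g where "g e = the_inv_into (arcs H) (arc_to_ends H) (f (tail G e), f (head G e))" for e
  have ends: "g e \<in> arcs H \<and> arc_to_ends H (g e) = (f (tail G e), f (head G e))"
    if e: "e \<in> arcs G" for e
  proof -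
    have "(f (tail G e), f (head G e)) \<in> arc_to_ends H ` arcs H"
      using adj[of "tail G e" "head G e"] e by (auto simp: arcs_ends_def arc_to_ends_def)
    then show ?thesis
      unfolding g_def using H.inj_on_arc_to_ends
      by (meson f_the_inv_into_f the_inv_into_into order_refl)
  qed
  have inj_g: "inj_on g (arcs G)"
  proof (rule inj_onI)
    fix e e' assume e: "e \<in> arcs G" "e' \<in> arcs G" "g e = g e'"
    then have "f (tail G e) = f (tail G e')" "f (head G e) = f (head G e')"
      using ends[OF e(1)] ends[OF e(2)] by auto
    then have "arc_to_ends G e = arc_to_ends G e'"
      using e f by (auto simp: arc_to_ends_def bij_betw_def inj_on_def)
    then show "e = e'" using e G.no_multi_arcs by blast
  qed
  have g_arcs: "g ` arcs G = arcs H"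
  proof
    show "g ` arcs G \<subseteq> arcs H" using ends by blast
    show "arcs H \<subseteq> g ` arcs G"
    proof
      fix e assume e: "e \<in> arcs H"
      then have "tail H e \<in> f ` verts G" "head H e \<in> f ` verts G"
        using f by (simp_all add: bij_betw_def)
      then obtain u v where uv: "u \<in> verts G" "v \<in> verts G" "f u = tail H e" "f v = head H e"
        by auto
      have "(f u, f v) \<in> arcs_ends H" using e uv by (auto simp: arcs_ends_conv)
      then have "(u, v) \<in> arcs_ends G" using adj uv by simp
      then obtain e' where e': "e' \<in> arcs G" "tail G e' = u" "head G e' = v"
        by (rule reachableE)
      have "arc_to_ends H (g e') = arc_to_ends H e"
        using ends[OF e'(1)] e' uv by (simp add: arc_to_ends_def)
      then have "g e' = e" using ends[OF e'(1)] e H.no_multi_arcs by blast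
      then show "e \<in> g ` arcs G" using e'(1) by blast
    qed
  qed
  define h where "h = \<lparr>iso_verts = f, iso_arcs = g, iso_head = head H, iso_tail = tail H\<rparr>"
  have "G.digraph_isomorphism h"
    unfolding G.digraph_isomorphism_def
    using f inj_g ends G.wf_digraph by (auto simp: h_def bij_betw_def arc_to_ends_def)
  moreover have "H = app_iso h G"
    using f g_arcs by (simp add: app_iso_def h_def bij_betw_def)
  ultimately show ?thesis unfolding digraph_iso_def by blast
qed

lemma graph_code_eq_imp_iso:
  assumes G: "graph G" and H: "graph H" and code: "graph_code G = graph_code H"
  shows "digraph_iso G H"
proof -
  define n where "n = card (verts G)"
  have nH: "card (verts H) = n" using code by (simp add: graph_code_def n_def)
  have fin: "finite (verts G)" "finite (verts H)"
    using G H by (simp_all add: graph_def digraph_def fin_digraph.finite_verts)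
  have bij: "bij_betw ((!) (vertex_list G)) {..<n} (verts G)"
    "bij_betw ((!) (vertex_list H)) {..<n} (verts H)"
    using vertex_list[OF fin(1)] vertex_list[OF fin(2)] nH
    by (auto intro!: bij_betw_nth simp: n_def)
  define f where "f = (!) (vertex_list H) \<circ> the_inv_into {..<n} ((!) (vertex_list G))"
  have f: "bij_betw f (verts G) (verts H)"
    unfolding f_def using bij_betw_the_inv_into[OF bij(1)] bij(2) by (rule bij_betw_trans)
  have f_nth: "f (vertex_list G ! i) = vertex_list H ! i" if "i < n" for i
    using bij(1) that by (simp add: f_def the_inv_into_f_f bij_betw_def)
  have "(u, v) \<in> arcs_ends G \<longleftrightarrow> (f u, f v) \<in> arcs_ends H"
    if uv: "u \<in> verts G" "v \<in> verts G" for u v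
  proof -
    have "u \<in> (!) (vertex_list G) ` {..<n}" "v \<in> (!) (vertex_list G) ` {..<n}"
      using bij(1) uv by (simp_all add: bij_betw_def)
    then obtain i j where ij: "i < n" "j < n" "u = vertex_list G ! i" "v = vertex_list G ! j"
      by auto
    have "snd (graph_code G) = snd (graph_code H)" using code by simp
    then have "(i, j) \<in> snd (graph_code G) \<longleftrightarrow> (i, j) \<in> snd (graph_code H)" by simp
    then show ?thesis
      using ij nH by (simp add: graph_code_def f_nth flip: n_def)
  qed
  then show ?thesis by (rule digraph_isoI[OF G H f])
qed

text \<open>The relation lives on all pre-digraphs, and reversing it uses that \<open>G\<close> is
  well-formed; hence classes are compared directly instead of through an equivalence
  relation.\<close>

lemma iso_class_eq:
  assumes "graph G" "graph H" "digraph_iso G H"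
  shows "{(G, H). digraph_iso G H} `` {G} = {(G, H). digraph_iso G H} `` {H}"
proof -
  have "wf_digraph G"
    using assms(1) by (simp add: graph_def digraph_def fin_digraph_def)
  then have "digraph_iso H G" using assms(3) by (rule digraph_iso_swap)
  then show ?thesis using assms(3) by (auto intro: digraph_iso_trans)
qed

text \<open>A class is determined by the code of any member satisfying the size bound, and such
  codes are finite in number. The set of graphs itself may be infinite.\<close>

lemma finite_iso_classes:
  "finite ({G :: ('a, 'b) pre_digraph. graph G \<and> card (verts G) \<le> N} // {(G, H). digraph_iso G H})"
proof -
  define A where "A = {G :: ('a, 'b) pre_digraph. graph G \<and> card (verts G) \<le> N}"
  define cls :: "('a, 'b) pre_digraph \<Rightarrow> ('a, 'b) pre_digraph set"
    where "cls G = {(G, H). digraph_iso G H} `` {G}" for G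
  have "graph_code ` A \<subseteq> {..N} \<times> Pow ({..<N} \<times> {..<N})"
    by (auto simp: A_def graph_code_def)
  then have "finite (graph_code ` A)" by (rule finite_subset) auto
  moreover have "cls ` A \<subseteq> (\<lambda>c. cls (SOME G. G \<in> A \<and> graph_code G = c)) ` graph_code ` A"
  proof
    fix c assume "c \<in> cls ` A"
    then obtain G where G: "G \<in> A" "c = cls G" by blast
    define H where "H = (SOME H. H \<in> A \<and> graph_code H = graph_code G)"
    have H: "H \<in> A \<and> graph_code H = graph_code G"
      unfolding H_def by (rule someI[of _ G]) (simp add: G)
    then have "cls G = cls H"
      unfolding cls_def using G by (intro iso_class_eq graph_code_eq_imp_iso) (auto simp: A_def)
    then show "c \<in> (\<lambda>c. cls (SOME G. G \<in> A \<and> graph_code G = c)) ` graph_code ` A"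
      using G by (auto simp: H_def)
  qed
  ultimately have "finite (cls ` A)" by (meson finite_imageI finite_subset)
  moreover have "A // {(G, H). digraph_iso G H} = cls ` A"
    by (auto simp: quotient_def cls_def)
  ultimately show ?thesis by (simp add: A_def)
qed

theorem theorem7p8:
  fixes \<omega> :: real and D :: nat
  assumes "\<omega> \<ge> 2" and "D \<ge> 3"
  shows "finite ({G :: ('a, 'b) pre_digraph.
      Digraph.graph G \<and> Digraph_Component.connected G \<and>
      walk_regular 2 G \<and> graph_diameter G = ereal (real D) \<and>
      smallest_eigenvalue G \<ge> - \<omega> \<and> \<not> geometric G} // {(G, H). digraph_iso G H})"
    (is "finite (?A // ?r)")
proof (rule finite_subset)
  let ?B = "{G :: ('a, 'b) pre_digraph. graph G \<and> card (verts G) \<le> (degree_bound \<omega> D + 1) ^ D}"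
  have "?A \<subseteq> ?B"
    using assms graph.geometric_or_card_verts_le[of _ D \<omega>] by auto
  then show "?A // ?r \<subseteq> ?B // ?r" unfolding quotient_def by blast
  show "finite (?B // ?r)" by (rule finite_iso_classes)
qed

end
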